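(* Let $m,n\ge 1$ be integers. For a shape $S$, let $\mathrm{diam}(\mathcal{F}_S)$ be the diameter of its domino flip graph $\mathcal{F}_S$. (1) If $S$ is an $n\times n$ square with $n$ even, then $$\mathrm{diam}(\mathcal{F}_S)=\frac{n^3-n}{6}.$$ (2) If $S$ is an $m\times n$ rectangle with $m\geqslant n$ and at least one of $m,n$ even, then $$\mathrm{diam}(\mathcal{F}_S)=\begin{cases}\dfrac{mn^2}{4}-\dfrac{n^3}{12}-\dfrac{n}{6} & \text{if } n \text{ is even},\\[2mm] \dfrac{mn^2}{4}-\dfrac{n^3}{12}+\dfrac{n}{12}-\dfrac{m}{4} & \text{otherwise.}\end{cases}$$ (3) If $S$ is an Aztec diamond of order $n$, then $$\mathrm{diam}(\mathcal{F}_S)=\frac{n^3}{3}+\frac{n^2}{2}+\frac{n}{6}.$$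
   Context: Shapes are unions of unit squares of the standard square tiling of the plane. The $m\times n$ rectangle is a rectangle made of $mn$ unit squares. The Aztec diamond of order $n$ is the union of all unit squares with integer corners that are contained in $\{(x,y)\in\mathbb{R}^2 : |x|+|y|\le n+1\}$. A domino tiling of $S$ is a tiling of $S$ by $2\times 1$ rectangles (dominos), each consisting of two unit squares of $S$ sharing an edge. If two dominos of a tiling share a long edge, they fill a $2\times 2$ square, and rotating this square by a quarter turn yields a new tiling; this operation is a flip. The flip graph $\mathcal{F}_S$ has the domino tilings of $S$ as vertices, with an edge between two tilings related by a single flip. Its diameter $\mathrm{diam}(\mathcal{F}_S)$ is the maximal graph distance (minimum number of flips) between two domino tilings of $S$. *)

theory Defs
  imports "HOL-Library.Disjoint_Sets" "Graph_Theory.Graph_Theory"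
begin

text \<open>A unit square of the standard tiling is represented by its lower-left corner, and a shape
  by the set of unit squares of which it is the union.\<close>

type_synonym cell = "int \<times> int"
type_synonym shape = "cell set"
type_synonym tiling = "cell set set"

fun unit_square :: "cell \<Rightarrow> (real \<times> real) set" where
  "unit_square (i, j) = {of_int i .. of_int i + 1} \<times> {of_int j .. of_int j + 1}"

definition rectangle :: "nat \<Rightarrow> nat \<Rightarrow> shape" where
  "rectangle m n = {0..<int m} \<times> {0..<int n}"

definition aztec_diamond :: "nat \<Rightarrow> shape" where
  "aztec_diamond n = {c. unit_square c \<subseteq> {(x, y). \<bar>x\<bar> + \<bar>y\<bar> \<le> real n + 1}}"

definition hdomino :: "int \<Rightarrow> int \<Rightarrow> cell set" where
  "hdomino i j = {(i, j), (i + 1, j)}"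

definition vdomino :: "int \<Rightarrow> int \<Rightarrow> cell set" where
  "vdomino i j = {(i, j), (i, j + 1)}"

definition domino :: "cell set \<Rightarrow> bool" where
  "domino d \<longleftrightarrow> (\<exists>i j. d = hdomino i j \<or> d = vdomino i j)"

definition domino_tilings :: "shape \<Rightarrow> tiling set" where
  "domino_tilings S = {T. partition_on S T \<and> (\<forall>d\<in>T. domino d)}"

text \<open>The two ways of filling the \<open>2 \<times> 2\<close> square with lower-left cell \<open>(i, j)\<close> by two dominos
  sharing a long edge; a quarter turn exchanges them.\<close>

definition hblock :: "int \<Rightarrow> int \<Rightarrow> tiling" where
  "hblock i j = {hdomino i j, hdomino i (j + 1)}"

definition vblock :: "int \<Rightarrow> int \<Rightarrow> tiling" where
  "vblock i j = {vdomino i j, vdomino (i + 1) j}"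

definition flip :: "tiling \<Rightarrow> tiling \<Rightarrow> bool" where
  "flip T T' \<longleftrightarrow> (\<exists>i j.
     hblock i j \<subseteq> T \<and> T' = (T - hblock i j) \<union> vblock i j \<or>
     vblock i j \<subseteq> T \<and> T' = (T - vblock i j) \<union> hblock i j)"

definition flip_graph :: "shape \<Rightarrow> tiling pair_pre_digraph" where
  "flip_graph S = \<lparr> pverts = domino_tilings S,
     parcs = {(T, T'). T \<in> domino_tilings S \<and> T' \<in> domino_tilings S \<and> flip T T'} \<rparr>"

text \<open>The undirected flip graph is represented by a symmetric digraph, one arc in each direction
  per edge.\<close>

lemma flip_sym: "flip T T' \<Longrightarrow> flip T' T"
  if "T \<in> domino_tilings S" "T' \<in> domino_tilings S"
proof -
  have disj: False if "A \<in> domino_tilings S" "d \<in> A" "e \<in> A" "d \<noteq> e" "d \<inter> e \<noteq> {}" for A d e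
    using that unfolding domino_tilings_def partition_on_def disjoint_def by blast
  have hv: False if "A \<in> domino_tilings S" "hblock i j \<subseteq> A" "d \<in> vblock i j" "d \<in> A" for A i j d
  proof -
    have "d \<noteq> hdomino i j \<and> d \<inter> hdomino i j \<noteq> {}"
      using that(3) by (auto simp: vblock_def vdomino_def hdomino_def doubleton_eq_iff)
    then show False using disj[of A d "hdomino i j"] that by (auto simp: hblock_def)
  qed
  have vh: False if "A \<in> domino_tilings S" "vblock i j \<subseteq> A" "d \<in> hblock i j" "d \<in> A" for A i j d
  proof -
    have "d \<noteq> vdomino i j \<and> d \<inter> vdomino i j \<noteq> {}"
      using that(3) by (auto simp: hblock_def vdomino_def hdomino_def doubleton_eq_iff)
    then show False using disj[of A d "vdomino i j"] that by (auto simp: vblock_def)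
  qed
  assume "flip T T'"
  then obtain i j where
    "hblock i j \<subseteq> T \<and> T' = (T - hblock i j) \<union> vblock i j \<or>
     vblock i j \<subseteq> T \<and> T' = (T - vblock i j) \<union> hblock i j"
    unfolding flip_def by blast
  then show "flip T' T"
  proof
    assume A: "hblock i j \<subseteq> T \<and> T' = (T - hblock i j) \<union> vblock i j"
    then have "vblock i j \<subseteq> T'" "T = (T' - vblock i j) \<union> hblock i j"
      using hv[OF \<open>T \<in> domino_tilings S\<close>, of i j] by auto
    then show ?thesis unfolding flip_def by blast
  next
    assume A: "vblock i j \<subseteq> T \<and> T' = (T - vblock i j) \<union> hblock i j"
    then have "hblock i j \<subseteq> T'" "T = (T' - hblock i j) \<union> vblock i j"
      using vh[OF \<open>T \<in> domino_tilings S\<close>, of i j] by auto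
    then show ?thesis unfolding flip_def by blast
  qed
qed

lemma pair_sym_digraph_flip_graph: "pair_sym_digraph (flip_graph S)"
proof
  show "symmetric (with_proj (flip_graph S))"
    unfolding symmetric_def using flip_sym by (auto simp: sym_def flip_graph_def)
qed (auto simp: flip_graph_def)

text \<open>Unit arc weights turn the shortest path cost into the minimum number of flips; it is
  infinite between different components. For a finite nonempty graph the supremum is attained,
  so it is the maximal distance.\<close>

definition graph_distance :: "'a pair_pre_digraph \<Rightarrow> 'a \<Rightarrow> 'a \<Rightarrow> ereal" where
  "graph_distance G u v = wf_digraph.\<mu> (with_proj G) (\<lambda>_. 1) u v"

definition graph_diameter :: "'a pair_pre_digraph \<Rightarrow> ereal" where
  "graph_diameter G = (SUP u\<in>pverts G. SUP v\<in>pverts G. graph_distance G u v)"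

end

theory Submission
  imports Defs
begin

text \<open>The proof uses Thurston's height functions. A domino tiling assigns integers to the lattice
  points of a shape without holes. Along an edge with a black cell on its left the height rises by
  one, or drops by three if a domino crosses the edge. The heights determine the tiling. On the
  boundary they are the same for all tilings, and a flip changes the height of a single vertex by
  four. So the flip distance of two tilings is at least a quarter of the sum of the absolute
  differences of their heights.

  Equality holds (\<open>graph_distance_flip_graph\<close>). If \<open>T\<close> is higher than \<open>T'\<close> somewhere, then among
  the vertices where it is higher, one of maximal height of \<open>T\<close> is a local maximum
  (\<open>local_extremum_where_higher\<close>), and around a local maximum two parallel dominoes can be flipped
  (\<open>flip_at_local_max\<close>), which brings \<open>T\<close> closer to \<open>T'\<close>.

  The same argument identifies the highest and the lowest tiling: a height function without local
  minimum at inner vertices is the highest one, a height function without local maximum the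
  lowest, and the diameter is a quarter of the sum of their differences
  (\<open>graph_diameter_flip_graph\<close>). Since every function with the right increments is the height
  function of a tiling (\<open>tiling_of_tiling\<close>), the extremal heights may simply be written down as
  formulas. For a rectangle a quarter of the difference at a vertex is its distance to the nearest
  side, and for the Aztec diamond of order \<open>n\<close> it is \<open>(n + 1 - \<bar>x\<bar> - \<bar>y\<bar>) div 2\<close>. Summing these
  yields the three formulas.

  Heights are built from column sums, which makes the theory elementary and applies to all finite
  shapes whose columns are intervals.\<close>

section \<open>Domino tilings through indicators\<close>

lemma domino_eq_simps [simp]:
  "hdomino i j = hdomino i' j' \<longleftrightarrow> i = i' \<and> j = j'"
  "vdomino i j = vdomino i' j' \<longleftrightarrow> i = i' \<and> j = j'"
  "hdomino i j \<noteq> vdomino i' j'" "vdomino i j \<noteq> hdomino i' j'"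
  by (auto simp: hdomino_def vdomino_def doubleton_eq_iff)

lemma domino_cases_at:
  assumes "domino d"
  shows "(x, y) \<in> d \<longleftrightarrow> d \<in> {hdomino x y, hdomino (x - 1) y, vdomino x y, vdomino x (y - 1)}"
proof -
  have "(x, y) \<in> hdomino i j \<longleftrightarrow> (i = x \<or> i = x - 1) \<and> j = y" for i j
    by (auto simp: hdomino_def)
  moreover have "(x, y) \<in> vdomino i j \<longleftrightarrow> i = x \<and> (j = y \<or> j = y - 1)" for i j
    by (auto simp: vdomino_def)
  ultimately show ?thesis using assms unfolding domino_def by auto
qed

abbreviation hor :: "tiling \<Rightarrow> int \<Rightarrow> int \<Rightarrow> int" where
  "hor T x y \<equiv> of_bool (hdomino x y \<in> T)"

abbreviation ver :: "tiling \<Rightarrow> int \<Rightarrow> int \<Rightarrow> int" where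
  "ver T x y \<equiv> of_bool (vdomino x y \<in> T)"

lemma card_dominoes_at:
  assumes "\<forall>d\<in>T. domino d"
  shows "finite {d\<in>T. (x, y) \<in> d}"
    "int (card {d\<in>T. (x, y) \<in> d}) = hor T x y + hor T (x - 1) y + ver T x y + ver T x (y - 1)"
proof -
  have eq: "{d\<in>T. (x, y) \<in> d} =
      {d \<in> {hdomino x y, hdomino (x - 1) y, vdomino x y, vdomino x (y - 1)}. d \<in> T}"
    using assms domino_cases_at by blast
  show "finite {d\<in>T. (x, y) \<in> d}" unfolding eq by simp
  have "int (card {d\<in>T. (x, y) \<in> d}) =
      (\<Sum>d\<in>{hdomino x y, hdomino (x - 1) y, vdomino x y, vdomino x (y - 1)}. of_bool (d \<in> T))"
    unfolding eq by (subst sum_of_bool_eq) (auto simp: Int_def)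
  then show "int (card {d\<in>T. (x, y) \<in> d}) =
      hor T x y + hor T (x - 1) y + ver T x y + ver T x (y - 1)" by simp
qed

lemma partition_on_iff_card:
  assumes "{} \<notin> T" "\<And>c. finite {d\<in>T. c \<in> d}"
  shows "partition_on S T \<longleftrightarrow> (\<forall>c. card {d\<in>T. c \<in> d} = of_bool (c \<in> S))"
proof
  assume P: "partition_on S T"
  show "\<forall>c. card {d\<in>T. c \<in> d} = of_bool (c \<in> S)"
  proof
    fix c
    show "card {d\<in>T. c \<in> d} = of_bool (c \<in> S)"
    proof (cases "c \<in> S")
      case True
      then obtain d where d: "d \<in> T" "c \<in> d" using P by (auto simp: partition_on_def)
      then have "{d\<in>T. c \<in> d} = {d}" using P by (auto simp: partition_on_def disjoint_def)
      then show ?thesis using True by simp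
    next
      case False
      then have "{d\<in>T. c \<in> d} = {}" using P by (auto simp: partition_on_def)
      then have "card {d\<in>T. c \<in> d} = 0" by (simp only: card.empty)
      then show ?thesis using False by simp
    qed
  qed
next
  assume C: "\<forall>c. card {d\<in>T. c \<in> d} = of_bool (c \<in> S)"
  have mem: "c \<in> S \<longleftrightarrow> (\<exists>d\<in>T. c \<in> d)" for c
    using C[rule_format, of c] assms(2)[of c]
    by (cases "c \<in> S") (auto simp: card_eq_0_iff card_1_singleton_iff)
  have uniq: "d = d'" if "d \<in> T" "d' \<in> T" "c \<in> d" "c \<in> d'" for c d d'
  proof -
    have "card {d\<in>T. c \<in> d} = 1" using C that mem[of c] by auto
    then obtain e where "{d\<in>T. c \<in> d} = {e}" by (auto simp: card_1_singleton_iff)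
    moreover have "d \<in> {d\<in>T. c \<in> d}" "d' \<in> {d\<in>T. c \<in> d}" using that by simp_all
    ultimately show ?thesis by simp
  qed
  show "partition_on S T" unfolding partition_on_def disjoint_def
  proof (intro conjI ballI impI)
    show "\<Union>T = S" using mem by auto
    show "d \<inter> d' = {}" if "d \<in> T" "d' \<in> T" "d \<noteq> d'" for d d' using uniq that by auto
  qed (rule assms(1))
qed

text \<open>Four dominoes can contain a given cell, so being a tiling is a linear condition on the
  indicators \<open>hor T\<close> and \<open>ver T\<close>: at every cell they add up to the indicator of the shape. All
  later arguments about tilings use this form.\<close>

lemma domino_tilings_iff:
  "T \<in> domino_tilings S \<longleftrightarrow> (\<forall>d\<in>T. domino d) \<and>
     (\<forall>x y. hor T x y + hor T (x - 1) y + ver T x y + ver T x (y - 1) = of_bool ((x, y) \<in> S))"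
proof (cases "\<forall>d\<in>T. domino d")
  case True
  have "\<not> domino {}" by (simp add: domino_def hdomino_def vdomino_def)
  then have "{} \<notin> T" using True by blast
  moreover have "finite {d\<in>T. c \<in> d}" for c using card_dominoes_at(1)[OF True] by (cases c) auto
  ultimately have "partition_on S T \<longleftrightarrow> (\<forall>c. card {d\<in>T. c \<in> d} = of_bool (c \<in> S))"
    by (rule partition_on_iff_card)
  also have "\<dots> \<longleftrightarrow> (\<forall>x y. card {d\<in>T. (x, y) \<in> d} = of_bool ((x, y) \<in> S))"
    by (simp only: split_paired_All)
  also have "\<dots> \<longleftrightarrow> (\<forall>x y. int (card {d\<in>T. (x, y) \<in> d}) = of_bool ((x, y) \<in> S))"
    by (intro iff_allI) (simp add: of_bool_def)
  finally show ?thesis using True by (simp add: domino_tilings_def card_dominoes_at(2))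
qed (auto simp: domino_tilings_def)

lemma tiling_count:
  assumes "T \<in> domino_tilings S"
  shows "hor T x y + hor T (x - 1) y + ver T x y + ver T x (y - 1) = of_bool ((x, y) \<in> S)"
  using assms by (simp add: domino_tilings_iff)

lemma tiling_mem:
  assumes "T \<in> domino_tilings S"
  shows "hdomino x y \<in> T \<Longrightarrow> (x, y) \<in> S \<and> (x + 1, y) \<in> S"
    "vdomino x y \<in> T \<Longrightarrow> (x, y) \<in> S \<and> (x, y + 1) \<in> S"
  using assms by (auto simp: domino_tilings_def partition_on_def hdomino_def vdomino_def)

text \<open>The chessboard colouring. It orients every edge of the lattice: the colours left and right of an
  edge differ.\<close>

definition checker :: "int \<Rightarrow> int \<Rightarrow> int" where
  "checker x y = 1 - 2 * ((x + y) mod 2)"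

lemma checker_cases: "checker x y = 1 \<or> checker x y = -1"
  unfolding checker_def by presburger

lemma checker_step [simp]:
  "checker (x + 1) y = - checker x y" "checker x (y + 1) = - checker x y"
  "checker (x - 1) y = - checker x y" "checker x (y - 1) = - checker x y"
  unfolding checker_def mod2_eq_if by auto

text \<open>The two ways of filling a \<open>2 \<times> 2\<close> square cover every cell equally often, so flips preserve
  tilings.\<close>

lemma block_cover_eq:
  fixes x i y j :: int
  shows "of_bool (x = i \<and> (y = j \<or> y = j + 1)) + of_bool (x - 1 = i \<and> (y = j \<or> y = j + 1)) =
    (of_bool ((x = i \<or> x = i + 1) \<and> y = j) + of_bool ((x = i \<or> x = i + 1) \<and> y - 1 = j) :: int)"
  by auto

lemma hor_flip_hblock:
  assumes "hblock i j \<subseteq> T"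
  shows "hor ((T - hblock i j) \<union> vblock i j) x y = hor T x y - of_bool (x = i \<and> (y = j \<or> y = j + 1))"
  using assms by (auto simp: hblock_def vblock_def)

lemma flip_hblock:
  assumes T: "T \<in> domino_tilings S" and b: "hblock i j \<subseteq> T"
  shows "(T - hblock i j) \<union> vblock i j \<in> domino_tilings S"
proof -
  let ?U = "(T - hblock i j) \<union> vblock i j"
  note h = hor_flip_hblock[OF b]
  have nv: "vdomino x y \<notin> T" if "(x = i \<or> x = i + 1) \<and> y = j" for x y
    using tiling_count[OF T, of x j] b that by (auto simp: hblock_def of_bool_def split: if_splits)
  have v: "ver ?U x y = ver T x y + of_bool ((x = i \<or> x = i + 1) \<and> y = j)" for x y
    using nv[of x y] by (auto simp: hblock_def vblock_def)
  have "hor ?U x y + hor ?U (x - 1) y + ver ?U x y + ver ?U x (y - 1) = of_bool ((x, y) \<in> S)" for x y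
    unfolding tiling_count[OF T, symmetric] h v using block_cover_eq[of x i y j] by linarith
  moreover have "\<forall>d\<in>?U. domino d"
    using T by (auto simp: domino_tilings_def vblock_def domino_def)
  ultimately show ?thesis unfolding domino_tilings_iff by blast
qed

lemma flip_vblock:
  assumes T: "T \<in> domino_tilings S" and b: "vblock i j \<subseteq> T"
  shows "(T - vblock i j) \<union> hblock i j \<in> domino_tilings S"
proof -
  let ?U = "(T - vblock i j) \<union> hblock i j"
  have v: "ver ?U x y = ver T x y - of_bool ((x = i \<or> x = i + 1) \<and> y = j)" for x y
    using b by (auto simp: hblock_def vblock_def)
  have nh: "hdomino x y \<notin> T" if "x = i \<and> (y = j \<or> y = j + 1)" for x y
    using tiling_count[OF T, of i y] b that by (auto simp: vblock_def of_bool_def split: if_splits)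
  have h: "hor ?U x y = hor T x y + of_bool (x = i \<and> (y = j \<or> y = j + 1))" for x y
    using nh[of x y] by (auto simp: hblock_def vblock_def)
  have "hor ?U x y + hor ?U (x - 1) y + ver ?U x y + ver ?U x (y - 1) = of_bool ((x, y) \<in> S)" for x y
    unfolding tiling_count[OF T, symmetric] h v using block_cover_eq[of x i y j] by linarith
  moreover have "\<forall>d\<in>?U. domino d"
    using T by (auto simp: domino_tilings_def hblock_def domino_def)
  ultimately show ?thesis unfolding domino_tilings_iff by blast
qed

lemma unflip_vblock:
  assumes T: "T \<in> domino_tilings S" and b: "vblock i j \<subseteq> T"
  shows "((T - vblock i j) \<union> hblock i j) - hblock i j \<union> vblock i j = T"
proof -
  have "hblock i j \<inter> T = {}"
    using tiling_count[OF T, of i j] tiling_count[OF T, of i "j + 1"] b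
    by (auto simp: vblock_def hblock_def of_bool_def split: if_splits)
  moreover have "vblock i j \<inter> hblock i j = {}" by (auto simp: vblock_def hblock_def)
  ultimately show ?thesis using b by auto
qed

section \<open>Differences of heights\<close>

definition column_convex :: "shape \<Rightarrow> bool" where
  "column_convex S \<longleftrightarrow>
     (\<forall>x a y b. (x, a) \<in> S \<longrightarrow> (x, b) \<in> S \<longrightarrow> a \<le> y \<longrightarrow> y \<le> b \<longrightarrow> (x, y) \<in> S)"

text \<open>The lattice points that are surrounded by four cells of the shape. In a column-convex shape two
  tilings can have different heights only there, and each flip takes place around one of them.\<close>

definition inner_vertices :: "shape \<Rightarrow> (int \<times> int) set" where
  "inner_vertices S =
     {(x, y). (x, y) \<in> S \<and> (x - 1, y) \<in> S \<and> (x, y - 1) \<in> S \<and> (x - 1, y - 1) \<in> S}"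

text \<open>A quarter of the difference of the heights (in the sense of Thurston) of two tilings at a
  lattice point. Walking up a vertical line from below the shape, the height changes by a fixed
  amount per edge, and additionally by four, with the sign of the colouring, whenever a domino of
  the tiling crosses the edge. The fixed amounts cancel in the difference, so no base point is
  needed.\<close>

definition height_diff :: "shape \<Rightarrow> tiling \<Rightarrow> tiling \<Rightarrow> int \<Rightarrow> int \<Rightarrow> int" where
  "height_diff S T T' x y =
     (\<Sum>y' | (x, y') \<in> S \<and> y' < y. checker x y' * (hor T (x - 1) y' - hor T' (x - 1) y'))"

lemma height_diff_commute: "height_diff S T T' x y = - height_diff S T' T x y"
  unfolding height_diff_def sum_negf[symmetric] by (intro sum.cong) (auto simp: algebra_simps)

lemma height_diff_self [simp]: "height_diff S T T x y = 0"
  by (simp add: height_diff_def)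

lemma height_diff_trans:
  "height_diff S T T'' x y = height_diff S T T' x y + height_diff S T' T'' x y"
  unfolding height_diff_def sum.distrib[symmetric] by (intro sum.cong) (auto simp: algebra_simps)

locale finite_shape =
  fixes S :: shape
  assumes finite_S: "finite S"
begin

lemma finite_column: "finite {y'. (x, y') \<in> S \<and> y' < y}"
  by (rule finite_subset[OF _ finite_imageI[OF finite_S, of snd]]) force

lemma finite_inner: "finite (inner_vertices S)"
  by (rule finite_subset[OF _ finite_S]) (auto simp: inner_vertices_def)

lemma S_bounded: obtains k where "\<And>x y. (x, y) \<in> S \<Longrightarrow> \<bar>x\<bar> < k \<and> \<bar>y\<bar> < k"
proof -
  define M where "M = (\<Sum>c\<in>S. \<bar>fst c\<bar> + \<bar>snd c\<bar>) + 1"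
  have "\<bar>x\<bar> < M \<and> \<bar>y\<bar> < M" if "(x, y) \<in> S" for x y
    using member_le_sum[OF that, of "\<lambda>c. \<bar>fst c\<bar> + \<bar>snd c\<bar>"] finite_S by (auto simp: M_def)
  then show ?thesis using that by blast
qed

lemma height_diff_north:
  assumes "T \<in> domino_tilings S" "T' \<in> domino_tilings S"
  shows "height_diff S T T' x (y + 1) =
    height_diff S T T' x y + checker x y * (hor T (x - 1) y - hor T' (x - 1) y)"
proof (cases "(x, y) \<in> S")
  case True
  then have "{y'. (x, y') \<in> S \<and> y' < y + 1} = insert y {y'. (x, y') \<in> S \<and> y' < y}" by auto
  then show ?thesis unfolding height_diff_def using finite_column[of x y] by simp
next
  case False
  then have "{y'. (x, y') \<in> S \<and> y' < y + 1} = {y'. (x, y') \<in> S \<and> y' < y}"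
    by (auto simp: order_less_le)
  moreover have "hdomino (x - 1) y \<notin> T" "hdomino (x - 1) y \<notin> T'"
    using tiling_mem(1)[OF assms(1), of "x - 1" y] tiling_mem(1)[OF assms(2), of "x - 1" y] False by auto
  ultimately show ?thesis unfolding height_diff_def by simp
qed

lemma height_diff_below:
  assumes "T \<in> domino_tilings S" "T' \<in> domino_tilings S"
    and "\<And>y'. y' < y \<Longrightarrow> (x, y') \<notin> S \<or> (x - 1, y') \<notin> S"
  shows "height_diff S T T' x y = 0"
  unfolding height_diff_def
proof (intro sum.neutral ballI)
  fix y' assume "y' \<in> {y'. (x, y') \<in> S \<and> y' < y}"
  then have "hdomino (x - 1) y' \<notin> T" "hdomino (x - 1) y' \<notin> T'"
    using tiling_mem(1)[OF assms(1), of "x - 1" y'] tiling_mem(1)[OF assms(2), of "x - 1" y']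
      assms(3)[of y'] by auto
  then show "checker x y' * (hor T (x - 1) y' - hor T' (x - 1) y') = 0" by simp
qed

text \<open>Path independence. The definition only uses vertical paths; a horizontal edge follows the
  analogous rule because, one cell up, the left and the right path differ by the four dominoes at
  that cell, of which both tilings use the same number. This holds at all lattice points because
  the shape is the same for both tilings.\<close>

lemma height_diff_east:
  assumes T: "T \<in> domino_tilings S" and T': "T' \<in> domino_tilings S"
  shows "height_diff S T T' (x + 1) y =
    height_diff S T T' x y - checker x y * (ver T x (y - 1) - ver T' x (y - 1))" (is "?P y")
proof -
  obtain k where k: "\<And>x y. (x, y) \<in> S \<Longrightarrow> \<bar>x\<bar> < k \<and> \<bar>y\<bar> < k" using S_bounded by blast
  have low: "?P y" if "y \<le> - k" for y
  proof -
    have no: "(a, b) \<notin> S" if "b < y" for a b using k[of a b] that \<open>y \<le> - k\<close> by auto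
    then have "height_diff S T T' (x + 1) y = 0" "height_diff S T T' x y = 0"
      by (auto intro!: height_diff_below[OF T T'])
    moreover have "vdomino x (y - 1) \<notin> T" "vdomino x (y - 1) \<notin> T'"
      using no[of "y - 1" x] tiling_mem(2)[OF T] tiling_mem(2)[OF T'] by auto
    ultimately show ?thesis by simp
  qed
  have "?P y" if "y \<ge> - k" for y using that
  proof (induction y rule: int_ge_induct)
    case base
    show ?case by (rule low) simp
  next
    case (step y)
    have "hor T x y + hor T (x - 1) y + ver T x y + ver T x (y - 1) =
        hor T' x y + hor T' (x - 1) y + ver T' x y + ver T' x (y - 1)"
      unfolding tiling_count[OF T] tiling_count[OF T'] ..
    moreover have "height_diff S T T' (x + 1) (y + 1) =
        height_diff S T T' (x + 1) y - checker x y * (hor T x y - hor T' x y)"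
      using height_diff_north[OF T T', of "x + 1" y] by simp
    ultimately show ?case
      unfolding height_diff_north[OF T T', of x y] step.IH checker_step add_diff_cancel_right'
      by algebra
  qed
  then show ?thesis using low by (cases "y \<le> - k") auto
qed

text \<open>Above the top of a column the difference no longer depends on \<open>y\<close>, and far above the shape a
  horizontal path from the left meets no domino.\<close>

lemma height_diff_above:
  assumes T: "T \<in> domino_tilings S" and T': "T' \<in> domino_tilings S"
    and no: "\<And>y'. y' \<ge> y \<Longrightarrow> (x, y') \<notin> S \<or> (x - 1, y') \<notin> S"
  shows "height_diff S T T' x y = 0"
proof -
  obtain k where k: "\<And>x y. (x, y) \<in> S \<Longrightarrow> \<bar>x\<bar> < k \<and> \<bar>y\<bar> < k" using S_bounded by blast
  define K where "K = max (k + 1) y"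
  have const: "height_diff S T T' x z = height_diff S T T' x y" if "z \<ge> y" for z using that
  proof (induction z rule: int_ge_induct)
    case (step z)
    then have "hdomino (x - 1) z \<notin> T" "hdomino (x - 1) z \<notin> T'"
      using no[of z] tiling_mem(1)[OF T, of "x - 1" z] tiling_mem(1)[OF T', of "x - 1" z] by auto
    then show ?case using step by (simp add: height_diff_north[OF T T'])
  qed simp
  have left: "height_diff S T T' z K = 0" if "z \<le> - k" for z
    using that k by (intro height_diff_below[OF T T']) fastforce
  have "height_diff S T T' z K = 0" if "z \<ge> - k" for z using that
  proof (induction z rule: int_ge_induct)
    case base
    show ?case by (rule left) simp
  next
    case (step z)
    have "(z, K - 1) \<notin> S \<or> (z, K) \<notin> S" using k[of z K] by (auto simp: K_def)
    then have "vdomino z (K - 1) \<notin> T" "vdomino z (K - 1) \<notin> T'"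
      using tiling_mem(2)[OF T, of z "K - 1"] tiling_mem(2)[OF T', of z "K - 1"] by auto
    then show ?case using step by (simp add: height_diff_east[OF T T'])
  qed
  then have "height_diff S T T' x K = 0" using left by (cases "x \<le> - k") auto
  then show ?thesis using const[of K] by (simp add: K_def)
qed

end

locale column_convex_shape = finite_shape +
  assumes convex: "column_convex S"
begin

text \<open>In a column-convex shape the vertical edges between two cells at a given abscissa form a
  segment. Hence from a point that is not an inner vertex, the vertical ray up or the one down
  contains none of them.\<close>

lemma height_diff_outer:
  assumes T: "T \<in> domino_tilings S" and T': "T' \<in> domino_tilings S"
    and outer: "(x, y) \<notin> inner_vertices S"
  shows "height_diff S T T' x y = 0"
proof (cases "\<forall>y'<y. (x, y') \<notin> S \<or> (x - 1, y') \<notin> S")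
  case True
  then show ?thesis by (intro height_diff_below[OF T T']) auto
next
  case False
  then obtain a where a: "a < y" "(x, a) \<in> S" "(x - 1, a) \<in> S" by auto
  show ?thesis
  proof (rule height_diff_above[OF T T'], rule ccontr)
    fix b assume b: "y \<le> b" "\<not> ((x, b) \<notin> S \<or> (x - 1, b) \<notin> S)"
    have "(z, c) \<in> S" if "z = x \<or> z = x - 1" "a \<le> c" "c \<le> b" for z c
      using convex a b that unfolding column_convex_def by blast
    then show False using outer a b by (auto simp: inner_vertices_def)
  qed
qed

text \<open>The two horizontal dominoes cross consecutive edges of the vertical line through the centre of
  the square. Their contributions have opposite signs, so they cancel above the centre.\<close>

lemma height_diff_flip:
  assumes T: "T \<in> domino_tilings S" and b: "hblock i j \<subseteq> T"
  shows "height_diff S T ((T - hblock i j) \<union> vblock i j) x y =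
    - checker i j * of_bool (x = i + 1 \<and> y = j + 1)"
proof (cases "x = i + 1")
  case True
  have S: "(i + 1, j) \<in> S" "(i + 1, j + 1) \<in> S" using tiling_mem(1)[OF T] b by (auto simp: hblock_def)
  let ?A = "{y'. (x, y') \<in> S \<and> y' < y}"
  have "height_diff S T ((T - hblock i j) \<union> vblock i j) x y =
      (\<Sum>y'\<in>?A. checker x y' * of_bool (y' = j \<or> y' = j + 1))"
    unfolding height_diff_def hor_flip_hblock[OF b] True by (intro sum.cong) auto
  also have "\<dots> = (\<Sum>y'\<in>?A \<inter> {j, j + 1}. checker x y')"
    by (rule sum.mono_neutral_cong_right) (use finite_column in auto)
  also have "?A \<inter> {j, j + 1} = (if y \<le> j then {} else if y = j + 1 then {j} else {j, j + 1})"
    using S True by auto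
  finally show ?thesis using True by auto
next
  case False
  then show ?thesis unfolding height_diff_def hor_flip_hblock[OF b] by simp
qed

end

section \<open>Height functions and their tilings\<close>

text \<open>The values of \<open>F\<close> are heights of \<open>T\<close> along all edges of cells of \<open>S\<close>: an increment is plus or
  minus one on an edge that is not crossed by a domino, and minus or plus three on one that is.\<close>

definition heights :: "shape \<Rightarrow> tiling \<Rightarrow> (int \<Rightarrow> int \<Rightarrow> int) \<Rightarrow> bool" where
  "heights S T F \<longleftrightarrow>
     (\<forall>x y. ((x, y) \<in> S \<or> (x, y - 1) \<in> S \<longrightarrow>
               F (x + 1) y = F x y + checker x y * (1 - 4 * ver T x (y - 1))) \<and>
            ((x, y) \<in> S \<or> (x - 1, y) \<in> S \<longrightarrow>
               F x (y + 1) = F x y - checker x y * (1 - 4 * hor T (x - 1) y)))"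

text \<open>The same increments without a tiling. Boundary edges must not be crossed.\<close>

definition height_function :: "shape \<Rightarrow> (int \<Rightarrow> int \<Rightarrow> int) \<Rightarrow> bool" where
  "height_function S F \<longleftrightarrow>
     (\<forall>x y.
        ((x, y) \<in> S \<and> (x, y - 1) \<in> S \<longrightarrow>
           F (x + 1) y - F x y \<in> {checker x y, - 3 * checker x y}) \<and>
        (((x, y) \<in> S) \<noteq> ((x, y - 1) \<in> S) \<longrightarrow> F (x + 1) y - F x y = checker x y) \<and>
        ((x, y) \<in> S \<and> (x - 1, y) \<in> S \<longrightarrow>
           F x (y + 1) - F x y \<in> {- checker x y, 3 * checker x y}) \<and>
        (((x, y) \<in> S) \<noteq> ((x - 1, y) \<in> S) \<longrightarrow> F x (y + 1) - F x y = - checker x y))"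

definition tiling_of :: "shape \<Rightarrow> (int \<Rightarrow> int \<Rightarrow> int) \<Rightarrow> tiling" where
  "tiling_of S F =
     {vdomino x y |x y. (x, y) \<in> S \<and> (x, y + 1) \<in> S \<and>
        F (x + 1) (y + 1) - F x (y + 1) \<noteq> checker x (y + 1)} \<union>
     {hdomino x y |x y. (x, y) \<in> S \<and> (x + 1, y) \<in> S \<and>
        F (x + 1) (y + 1) - F (x + 1) y \<noteq> - checker (x + 1) y}"

lemma heights_tiling_of:
  assumes "height_function S F"
  shows "heights S (tiling_of S F) F"
proof -
  have v: "vdomino x (y - 1) \<in> tiling_of S F \<longleftrightarrow> (x, y) \<in> S \<and> (x, y - 1) \<in> S \<and>
      F (x + 1) y - F x y \<noteq> checker x y" for x y
    by (auto simp: tiling_of_def)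
  have h: "hdomino (x - 1) y \<in> tiling_of S F \<longleftrightarrow> (x, y) \<in> S \<and> (x - 1, y) \<in> S \<and>
      F x (y + 1) - F x y \<noteq> - checker x y" for x y
    by (auto simp: tiling_of_def)
  show ?thesis unfolding heights_def
  proof (intro allI conjI impI)
    fix x y
    have *: "(x, y) \<in> S \<and> (x, y - 1) \<in> S \<longrightarrow>
           F (x + 1) y - F x y \<in> {checker x y, - 3 * checker x y}"
      "((x, y) \<in> S) \<noteq> ((x, y - 1) \<in> S) \<longrightarrow> F (x + 1) y - F x y = checker x y"
      using assms[unfolded height_function_def, THEN spec, THEN spec, of x y] by - (elim conjE, assumption)+
    assume "(x, y) \<in> S \<or> (x, y - 1) \<in> S"
    then show "F (x + 1) y = F x y + checker x y * (1 - 4 * ver (tiling_of S F) x (y - 1))"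
      unfolding v using * checker_cases[of x y] by (auto simp: of_bool_def)
  next
    fix x y
    have *: "(x, y) \<in> S \<and> (x - 1, y) \<in> S \<longrightarrow>
           F x (y + 1) - F x y \<in> {- checker x y, 3 * checker x y}"
      "((x, y) \<in> S) \<noteq> ((x - 1, y) \<in> S) \<longrightarrow> F x (y + 1) - F x y = - checker x y"
      using assms[unfolded height_function_def, THEN spec, THEN spec, of x y] by - (elim conjE, assumption)+
    assume "(x, y) \<in> S \<or> (x - 1, y) \<in> S"
    then show "F x (y + 1) = F x y - checker x y * (1 - 4 * hor (tiling_of S F) (x - 1) y)"
      unfolding h using * checker_cases[of x y] by (auto simp: of_bool_def)
  qed
qed

text \<open>The increments around a cell sum to zero. Up to sign each is 1 or \<open>-3\<close>, so exactly one of the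
  four edges is crossed, which says that exactly one domino covers the cell.\<close>

lemma tiling_of_tiling:
  assumes "height_function S F"
  shows "tiling_of S F \<in> domino_tilings S"
proof -
  let ?T = "tiling_of S F"
  note H = heights_tiling_of[OF assms, unfolded heights_def]
  have "hor ?T x y + hor ?T (x - 1) y + ver ?T x y + ver ?T x (y - 1) = of_bool ((x, y) \<in> S)" for x y
  proof (cases "(x, y) \<in> S")
    case True
    have "F (x + 1) y = F x y + checker x y * (1 - 4 * ver ?T x (y - 1))"
      "F x (y + 1) = F x y - checker x y * (1 - 4 * hor ?T (x - 1) y)"
      using H[rule_format, of x y] True by simp_all
    moreover have "F (x + 1) (y + 1) = F x (y + 1) - checker x y * (1 - 4 * ver ?T x y)"
      using H[rule_format, of x "y + 1"] True by simp
    moreover have "F (x + 1) (y + 1) = F (x + 1) y + checker x y * (1 - 4 * hor ?T x y)"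
      using H[rule_format, of "x + 1" y] True by simp
    \<comment> \<open>The increments around the cell add up to zero.\<close>
    ultimately have "checker x y *
        (hor ?T x y + hor ?T (x - 1) y + ver ?T x y + ver ?T x (y - 1) - 1) = 0" by algebra
    moreover have "checker x y \<noteq> 0" using checker_cases[of x y] by auto
    ultimately have "hor ?T x y + hor ?T (x - 1) y + ver ?T x y + ver ?T x (y - 1) - 1 = 0"
      by (simp only: mult_eq_0_iff simp_thms)
    then have "hor ?T x y + hor ?T (x - 1) y + ver ?T x y + ver ?T x (y - 1) = 1" by linarith
    then show ?thesis using True by (simp only: of_bool_eq)
  next
    case False
    then have "hdomino x y \<notin> ?T" "hdomino (x - 1) y \<notin> ?T" "vdomino x y \<notin> ?T" "vdomino x (y - 1) \<notin> ?T"
      by (auto simp: tiling_of_def)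
    then show ?thesis using False by simp
  qed
  moreover have "\<forall>d\<in>?T. domino d" by (auto simp: tiling_of_def domino_def)
  ultimately show ?thesis unfolding domino_tilings_iff by blast
qed

context finite_shape
begin

text \<open>One tiling with known heights provides heights for all tilings of the shape, with the same
  boundary values.\<close>

lemma heights_transfer:
  assumes "heights S T F" "T \<in> domino_tilings S" "T' \<in> domino_tilings S"
  shows "heights S T' (\<lambda>x y. F x y + 4 * height_diff S T' T x y)"
  unfolding heights_def
proof (intro allI conjI impI)
  fix x y
  note F = assms(1)[unfolded heights_def, rule_format, of x y]
  show "(F (x + 1) y + 4 * height_diff S T' T (x + 1) y) =
      F x y + 4 * height_diff S T' T x y + checker x y * (1 - 4 * ver T' x (y - 1))"
    if "(x, y) \<in> S \<or> (x, y - 1) \<in> S"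
    unfolding height_diff_east[OF assms(3,2)] conjunct1[OF F, rule_format, OF that] by algebra
  show "(F x (y + 1) + 4 * height_diff S T' T x (y + 1)) =
      F x y + 4 * height_diff S T' T x y - checker x y * (1 - 4 * hor T' (x - 1) y)"
    if "(x, y) \<in> S \<or> (x - 1, y) \<in> S"
    unfolding height_diff_north[OF assms(3,2)] conjunct2[OF F, rule_format, OF that] by algebra
qed

end

section \<open>Local extrema and flips\<close>

definition strict_local_max :: "(int \<Rightarrow> int \<Rightarrow> int) \<Rightarrow> int \<Rightarrow> int \<Rightarrow> bool" where
  "strict_local_max F x y \<longleftrightarrow>
     F (x + 1) y < F x y \<and> F (x - 1) y < F x y \<and> F x (y + 1) < F x y \<and> F x (y - 1) < F x y"

lemma heights_around:
  assumes "heights S T F" "(x, y) \<in> inner_vertices S"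
  shows "F (x + 1) y = F x y + checker x y * (1 - 4 * ver T x (y - 1))"
    "F (x - 1) y = F x y + checker x y * (1 - 4 * ver T (x - 1) (y - 1))"
    "F x (y + 1) = F x y - checker x y * (1 - 4 * hor T (x - 1) y)"
    "F x (y - 1) = F x y - checker x y * (1 - 4 * hor T (x - 1) (y - 1))"
  using assms(1)[unfolded heights_def, rule_format, of x y]
    assms(1)[unfolded heights_def, rule_format, of "x - 1" y]
    assms(1)[unfolded heights_def, rule_format, of x "y - 1"] assms(2)
  by (auto simp: inner_vertices_def)

context column_convex_shape
begin

text \<open>At a local maximum all four increments point downwards. The colours alternate around the vertex,
  so the two edges that must be crossed are opposite to each other, and the dominoes crossing them
  are parallel and share a long edge. Rotating them lowers the height at this vertex.\<close>

lemma flip_at_local_max: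
  assumes F: "heights S T F" and T: "T \<in> domino_tilings S"
    and v: "(x, y) \<in> inner_vertices S" and max: "strict_local_max F x y"
  obtains U where "U \<in> domino_tilings S" "flip T U"
    "\<And>a b. height_diff S T U a b = of_bool (a = x \<and> b = y)"
proof (cases "checker x y = 1")
  case True
  let ?U = "(T - vblock (x - 1) (y - 1)) \<union> hblock (x - 1) (y - 1)"
  have b: "vblock (x - 1) (y - 1) \<subseteq> T"
    using heights_around[OF F v] max True
    by (auto simp: vblock_def strict_local_max_def of_bool_def split: if_splits)
  have U: "?U \<in> domino_tilings S" using flip_vblock[OF T b] .
  have flip: "flip T ?U" using b unfolding flip_def by blast
  have hb: "hblock (x - 1) (y - 1) \<subseteq> ?U" by auto
  have "height_diff S T ?U a b = of_bool (a = x \<and> b = y)" for a b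
    using height_diff_flip[OF U hb, of a b] True
    unfolding unflip_vblock[OF T b] height_diff_commute[of S ?U T] by simp
  then show ?thesis using that U flip by blast
next
  case False
  then have c: "checker x y = -1" using checker_cases[of x y] by simp
  let ?U = "(T - hblock (x - 1) (y - 1)) \<union> vblock (x - 1) (y - 1)"
  have b: "hblock (x - 1) (y - 1) \<subseteq> T"
    using heights_around[OF F v] max c
    by (auto simp: hblock_def strict_local_max_def of_bool_def split: if_splits)
  have "height_diff S T ?U a b = of_bool (a = x \<and> b = y)" for a b
    using height_diff_flip[OF T b, of a b] c by simp
  moreover have "flip T ?U" using b unfolding flip_def by blast
  ultimately show ?thesis using that flip_hblock[OF T b] by blast
qed

text \<open>Where \<open>T\<close> is higher than \<open>T'\<close>, take a vertex of maximal height of \<open>T\<close>. At a neighbour that were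
  higher still, \<open>T\<close> would no longer exceed \<open>T'\<close>, so the increment of \<open>T\<close> would be the smaller one
  of the two admissible values, which is negative. The sign \<open>e\<close> also covers the symmetric
  statement about local minima where \<open>T\<close> is lower.\<close>

lemma local_extremum_where_higher:
  fixes e :: int
  assumes F: "heights S T F" and T: "T \<in> domino_tilings S" and T': "T' \<in> domino_tilings S"
    and e: "e = 1 \<or> e = -1" and pos: "e * height_diff S T T' x\<^sub>0 y\<^sub>0 > 0"
  obtains x y where "e * height_diff S T T' x y > 0" "(x, y) \<in> inner_vertices S"
    "strict_local_max (\<lambda>x y. e * F x y) x y"
proof -
  let ?D = "height_diff S T T'"
  define P where "P = {(x, y). e * ?D x y > 0}"
  have P: "P \<subseteq> inner_vertices S" using height_diff_outer[OF T T'] by (fastforce simp: P_def)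
  have "finite P" "P \<noteq> {}" using finite_subset[OF P finite_inner] pos by (auto simp: P_def)
  define g where "g w = e * F (fst w) (snd w)" for w
  have "Max (g ` P) \<in> g ` P" using \<open>finite P\<close> \<open>P \<noteq> {}\<close> by simp
  then obtain v where v: "v \<in> P" "g v = Max (g ` P)" by force
  obtain x y where xy: "v = (x, y)" by (cases v)
  have maximal: "e * ?D a b \<le> 0 \<or> e * F a b \<le> e * F x y" for a b
  proof (cases "(a, b) \<in> P")
    case True
    then have "g (a, b) \<le> g v" unfolding v(2) using \<open>finite P\<close> by simp
    then show ?thesis by (simp add: g_def xy)
  qed (auto simp: P_def)
  have inner: "(x, y) \<in> inner_vertices S" and D: "e * ?D x y > 0" using P v(1) xy by (auto simp: P_def)
  have key: "e * f' < e * f"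
    if "f' = f + s * (1 - 4 * of_bool p)" "d' = d - s * (of_bool p - of_bool q)" "s = 1 \<or> s = -1"
      "e * d > 0" "e * d' \<le> 0 \<or> e * f' \<le> e * f" for f f' d d' s :: int and p q
    using that e by (auto simp: of_bool_def split: if_splits)
  note D1 = height_diff_east[OF T T', of x y] and D2 = height_diff_east[OF T T', of "x - 1" y]
    and D3 = height_diff_north[OF T T', of x y] and D4 = height_diff_north[OF T T', of x "y - 1"]
  have s: "checker x y = 1 \<or> checker x y = -1" "- checker x y = 1 \<or> - checker x y = -1"
    using checker_cases[of x y] by auto
  have "e * F (x + 1) y < e * F x y"
    by (rule key[OF heights_around(1)[OF F inner] D1 s(1) D maximal])
  moreover have "e * F (x - 1) y < e * F x y"
  proof (rule key[OF heights_around(2)[OF F inner] _ s(1) D maximal])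
    show "?D (x - 1) y = ?D x y - checker x y *
        (ver T (x - 1) (y - 1) - ver T' (x - 1) (y - 1))"
      using D2 unfolding checker_step diff_add_cancel by algebra
  qed
  moreover have "e * F x (y + 1) < e * F x y"
  proof (rule key[OF _ _ s(2) D maximal])
    show "F x (y + 1) = F x y + - checker x y * (1 - 4 * hor T (x - 1) y)"
      using heights_around(3)[OF F inner] by algebra
    show "?D x (y + 1) = ?D x y - - checker x y * (hor T (x - 1) y - hor T' (x - 1) y)"
      using D3 by algebra
  qed
  moreover have "e * F x (y - 1) < e * F x y"
  proof (rule key[OF _ _ s(2) D maximal])
    show "F x (y - 1) = F x y + - checker x y * (1 - 4 * hor T (x - 1) (y - 1))"
      using heights_around(4)[OF F inner] by algebra
    show "?D x (y - 1) = ?D x y - - checker x y *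
        (hor T (x - 1) (y - 1) - hor T' (x - 1) (y - 1))"
      using D4 unfolding checker_step diff_add_cancel by algebra
  qed
  ultimately show ?thesis using that[OF D inner] by (simp add: strict_local_max_def)
qed

end

section \<open>Flip distance and diameter\<close>

text \<open>This will turn out to be the flip distance.\<close>

definition height_dist :: "shape \<Rightarrow> tiling \<Rightarrow> tiling \<Rightarrow> int" where
  "height_dist S T T' = (\<Sum>(x, y)\<in>inner_vertices S. \<bar>height_diff S T T' x y\<bar>)"

lemma height_dist_nonneg: "height_dist S T T' \<ge> 0"
  unfolding height_dist_def by (intro sum_nonneg) auto

lemma height_dist_commute: "height_dist S T T' = height_dist S T' T"
  unfolding height_dist_def by (simp add: height_diff_commute[of S T T'])

lemma height_dist_triangle: "height_dist S T T'' \<le> height_dist S T T' + height_dist S T' T''"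
  unfolding height_dist_def sum.distrib[symmetric]
  by (intro sum_mono) (auto simp: height_diff_trans[of S T T'' _ _ T'])

context column_convex_shape
begin

lemma height_dist_flip:
  assumes T: "T \<in> domino_tilings S" and U: "U \<in> domino_tilings S" and "flip T U"
  shows "height_dist S T U \<le> 1"
proof -
  have one: "height_dist S A ((A - hblock i j) \<union> vblock i j) \<le> 1"
    if A: "A \<in> domino_tilings S" "hblock i j \<subseteq> A" for A i j
  proof -
    have "height_dist S A ((A - hblock i j) \<union> vblock i j) =
        (\<Sum>v\<in>inner_vertices S. of_bool (v = (i + 1, j + 1)))"
      unfolding height_dist_def height_diff_flip[OF A]
      using checker_cases[of i j] by (intro sum.cong) (auto simp: abs_mult)
    also have "\<dots> \<le> 1" using finite_inner by (simp add: sum_of_bool_eq card_le_Suc0_iff_eq)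
    finally show ?thesis .
  qed
  from \<open>flip T U\<close> obtain i j where
    "hblock i j \<subseteq> T \<and> U = (T - hblock i j) \<union> vblock i j \<or>
     vblock i j \<subseteq> T \<and> U = (T - vblock i j) \<union> hblock i j"
    unfolding flip_def by blast
  then show ?thesis
  proof
    assume "hblock i j \<subseteq> T \<and> U = (T - hblock i j) \<union> vblock i j"
    then show ?thesis using one[OF T] by simp
  next
    assume A: "vblock i j \<subseteq> T \<and> U = (T - vblock i j) \<union> hblock i j"
    then have "U - hblock i j \<union> vblock i j = T" using unflip_vblock[OF T] by simp
    moreover have "hblock i j \<subseteq> U" using A by simp
    ultimately show ?thesis using one[OF U, of i j] by (simp add: height_dist_commute)
  qed
qed

lemma height_dist_eq_0:
  assumes T: "T \<in> domino_tilings S" and T': "T' \<in> domino_tilings S" and "height_dist S T T' = 0"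
  shows "T = T'"
proof -
  have D: "height_diff S T T' x y = 0" for x y
  proof (cases "(x, y) \<in> inner_vertices S")
    case True
    then show ?thesis using assms(3) finite_inner
      unfolding height_dist_def by (subst (asm) sum_nonneg_eq_0_iff) auto
  qed (rule height_diff_outer[OF T T'])
  have "hor T x y = hor T' x y" for x y
    using height_diff_north[OF T T', of "x + 1" y] checker_cases[of "x + 1" y] unfolding D by auto
  moreover have "ver T x y = ver T' x y" for x y
    using height_diff_east[OF T T', of x "y + 1"] checker_cases[of x "y + 1"] unfolding D by auto
  moreover have "domino d" if "d \<in> T \<or> d \<in> T'" for d
    using that T T' by (auto simp: domino_tilings_def)
  ultimately show ?thesis unfolding domino_def of_bool_eq_iff by blast
qed

text \<open>The flip lowers a local maximum of the height of \<open>T\<close> at which \<open>T\<close> exceeds \<open>T'\<close>.\<close>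

lemma flip_towards:
  assumes F: "heights S T F" and T: "T \<in> domino_tilings S" and T': "T' \<in> domino_tilings S"
    and pos: "height_diff S T T' x\<^sub>0 y\<^sub>0 > 0"
  obtains U where "U \<in> domino_tilings S" "flip T U" "height_dist S U T' = height_dist S T T' - 1"
proof -
  obtain x y where D: "height_diff S T T' x y > 0" and v: "(x, y) \<in> inner_vertices S"
      and max: "strict_local_max F x y"
    using local_extremum_where_higher[OF F T T', of 1 x\<^sub>0 y\<^sub>0] pos by auto
  obtain U where U: "U \<in> domino_tilings S" "flip T U"
    and TU: "\<And>a b. height_diff S T U a b = of_bool (a = x \<and> b = y)"
    using flip_at_local_max[OF F T v max] by blast
  have "height_diff S U T' a b = height_diff S T T' a b - of_bool (a = x \<and> b = y)" for a b
    using height_diff_trans[of S T T' a b U] TU[of a b] by simp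
  then have "height_dist S U T' =
      (\<Sum>(a, b)\<in>inner_vertices S. \<bar>height_diff S T T' a b\<bar> - of_bool ((a, b) = (x, y)))"
    unfolding height_dist_def using D by (intro sum.cong) auto
  also have "\<dots> = height_dist S T T' - (\<Sum>w\<in>inner_vertices S. of_bool (w = (x, y)))"
    unfolding height_dist_def sum_subtractf[symmetric] by (intro sum.cong) auto
  also have "(\<Sum>w\<in>inner_vertices S. of_bool (w = (x, y))) = (1 :: int)"
    using finite_inner v by (simp add: sum_of_bool_eq)
  finally show ?thesis using that U by blast
qed

text \<open>The tiling that is higher somewhere is the one to flip, so the walk grows from both of its ends.\<close>

lemma walk_of_length_height_dist:
  assumes F\<^sub>0: "heights S T\<^sub>0 F\<^sub>0" and T\<^sub>0: "T\<^sub>0 \<in> domino_tilings S"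
    and "T \<in> domino_tilings S" "T' \<in> domino_tilings S"
  shows "\<exists>p. pre_digraph.awalk (with_proj (flip_graph S)) T p T' \<and> int (length p) = height_dist S T T'"
  using assms(3,4)
proof (induction "nat (height_dist S T T')" arbitrary: T T')
  case 0
  then have "T = T'" using height_dist_eq_0 height_dist_nonneg[of S T T'] by simp
  then have "height_dist S T T' = 0" by (simp add: height_dist_def)
  then show ?case using \<open>T = T'\<close> 0 by (intro exI[of _ "[]"]) (simp add: pre_digraph.awalk_def flip_graph_def pre_digraph.cas.simps)
next
  case (Suc n)
  interpret G: pair_sym_digraph "flip_graph S" by (rule pair_sym_digraph_flip_graph)
  have arc: "G.awalk A [(A, B)] B" if "A \<in> domino_tilings S" "B \<in> domino_tilings S" "flip A B" for A B
  proof -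
    have "A \<in> pverts (flip_graph S)" "(A, B) \<in> parcs (flip_graph S)"
      using that by (simp_all add: flip_graph_def)
    then show ?thesis by (simp add: G.awalk_def)
  qed
  have "height_dist S T T' > 0" using Suc.hyps(2) by simp
  then obtain x y where "height_diff S T T' x y \<noteq> 0"
    by (force simp: height_dist_def)
  then consider "height_diff S T T' x y > 0" | "height_diff S T' T x y > 0"
    using height_diff_commute[of S T T' x y] by linarith
  then show ?case
  proof cases
    case 1
    obtain U where U: "U \<in> domino_tilings S" "flip T U" "height_dist S U T' = height_dist S T T' - 1"
      using flip_towards[OF heights_transfer[OF F\<^sub>0 T\<^sub>0 Suc.prems(1)] Suc.prems 1] .
    have "n = nat (height_dist S U T')" using U(3) Suc.hyps(2) by linarith
    from Suc.hyps(1)[OF this U(1) Suc.prems(2)] obtain p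
      where p: "G.awalk U p T'" "int (length p) = height_dist S U T'" by blast
    have "G.awalk T ([(T, U)] @ p) T'"
      by (rule G.awalk_appendI[OF arc[OF Suc.prems(1) U(1,2)] p(1)])
    moreover have "int (length ([(T, U)] @ p)) = height_dist S T T'" using p(2) U(3) by simp
    ultimately show ?thesis by blast
  next
    case 2
    obtain U where U: "U \<in> domino_tilings S" "flip T' U" "height_dist S U T = height_dist S T' T - 1"
      using flip_towards[OF heights_transfer[OF F\<^sub>0 T\<^sub>0 Suc.prems(2)] Suc.prems(2,1) 2] .
    have *: "height_dist S T U = height_dist S T T' - 1" using U(3) by (simp add: height_dist_commute)
    have "n = nat (height_dist S T U)" using * Suc.hyps(2) by linarith
    from Suc.hyps(1)[OF this Suc.prems(1) U(1)] obtain p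
      where p: "G.awalk T p U" "int (length p) = height_dist S T U" by blast
    have "G.awalk T (p @ [(U, T')]) T'"
      by (rule G.awalk_appendI[OF p(1) arc[OF U(1) Suc.prems(2) flip_sym[OF Suc.prems(2) U(1,2)]]])
    moreover have "int (length (p @ [(U, T')])) = height_dist S T T'" using p(2) * by simp
    ultimately show ?thesis by blast
  qed
qed

lemma height_dist_le_walk:
  assumes "pre_digraph.awalk (with_proj (flip_graph S)) T p T'"
  shows "height_dist S T T' \<le> int (length p)"
  using assms
proof (induction p arbitrary: T)
  case Nil
  then show ?case by (simp add: pre_digraph.awalk_def pre_digraph.cas.simps height_dist_def)
next
  case (Cons e p)
  interpret G: pair_sym_digraph "flip_graph S" by (rule pair_sym_digraph_flip_graph)
  obtain U where e: "e = (T, U)" and w: "G.awalk U p T'" and arc: "(T, U) \<in> parcs (flip_graph S)"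
    using Cons.prems by (cases e) (auto simp: G.awalk_Cons_iff)
  have "height_dist S T U \<le> 1" using arc by (intro height_dist_flip) (auto simp: flip_graph_def)
  then show ?case using Cons.IH[OF w] height_dist_triangle[of S T T' U] by simp
qed

theorem graph_distance_flip_graph:
  assumes "heights S T\<^sub>0 F\<^sub>0" "T\<^sub>0 \<in> domino_tilings S" "T \<in> domino_tilings S" "T' \<in> domino_tilings S"
  shows "graph_distance (flip_graph S) T T' = ereal (real_of_int (height_dist S T T'))"
proof -
  interpret G: pair_sym_digraph "flip_graph S" by (rule pair_sym_digraph_flip_graph)
  have cost: "G.awalk_cost (\<lambda>_. 1) p = real (length p)" for p by (induction p) auto
  obtain p where p: "G.awalk T p T'" "int (length p) = height_dist S T T'"
    using walk_of_length_height_dist[OF assms] by blast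
  have "real_of_int (height_dist S T T') \<le> real (length q)" if "G.awalk T q T'" for q
    using height_dist_le_walk[OF that] by linarith
  moreover have "real (length p) = real_of_int (height_dist S T T')" unfolding p(2)[symmetric] by simp
  ultimately show ?thesis unfolding graph_distance_def G.\<mu>_def cost
    using p(1) by (intro antisym INF_greatest INF_lower2[of p]) auto
qed

text \<open>If the height function \<open>Fmin\<close> has no interior local maximum, no tiling can be lower than its
  tiling anywhere, because \<open>local_extremum_where_higher\<close> would provide a local maximum; likewise
  for \<open>Fmax\<close>. All heights thus lie between the two, and the extremal tilings are at maximal
  distance. The premise on equal values concerns the lower ends of vertical edges between two
  cells: from such a boundary vertex, \<open>Fmax - Fmin\<close> and the height difference of the tilings are
  compared by walking up.\<close>

theorem graph_diameter_flip_graph: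
  assumes F: "height_function S Fmax" "height_function S Fmin"
    and base: "\<And>x y. (x, y) \<in> S \<Longrightarrow> (x - 1, y) \<in> S \<Longrightarrow> (x, y) \<notin> inner_vertices S \<Longrightarrow> Fmax x y = Fmin x y"
    and max: "\<And>x y. (x, y) \<in> inner_vertices S \<Longrightarrow> \<not> strict_local_max (\<lambda>x y. - Fmax x y) x y"
    and min: "\<And>x y. (x, y) \<in> inner_vertices S \<Longrightarrow> \<not> strict_local_max Fmin x y"
    and diff: "\<And>x y. (x, y) \<in> inner_vertices S \<Longrightarrow> Fmax x y - Fmin x y = 4 * d x y"
  shows "graph_diameter (flip_graph S) = ereal (real_of_int (\<Sum>(x, y)\<in>inner_vertices S. d x y))"
proof -
  define A B where "A = tiling_of S Fmax" and "B = tiling_of S Fmin"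
  have A: "A \<in> domino_tilings S" "heights S A Fmax" and B: "B \<in> domino_tilings S" "heights S B Fmin"
    unfolding A_def B_def using F by (auto intro: tiling_of_tiling heights_tiling_of)
  obtain k where k: "\<And>x y. (x, y) \<in> S \<Longrightarrow> \<bar>x\<bar> < k \<and> \<bar>y\<bar> < k" using S_bounded by blast
  have eq: "Fmax x y - Fmin x y = 4 * height_diff S A B x y"
    if "y \<ge> - k" "(x, y) \<in> S" "(x - 1, y) \<in> S" for x y using that
  proof (induction y rule: int_ge_induct)
    case base
    then show ?case using k by fastforce
  next
    case (step y)
    show ?case
    proof (cases "(x, y + 1) \<in> inner_vertices S")
      case False
      then show ?thesis using step.prems assms(3) height_diff_outer[OF A(1) B(1)] by simp
    next
      case True
      then have S: "(x, y) \<in> S" "(x - 1, y) \<in> S" by (auto simp: inner_vertices_def)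
      have "Fmax x (y + 1) = Fmax x y - checker x y * (1 - 4 * hor A (x - 1) y)"
        "Fmin x (y + 1) = Fmin x y - checker x y * (1 - 4 * hor B (x - 1) y)"
        using A(2) B(2) S unfolding heights_def by auto
      then show ?thesis using step.IH[OF S] unfolding height_diff_north[OF A(1) B(1)] by algebra
    qed
  qed
  have D: "height_diff S A B x y = d x y" if "(x, y) \<in> inner_vertices S" for x y
    using eq[of y x] diff[OF that] k[of x y] that by (auto simp: inner_vertices_def)
  have A_max: "height_diff S A T x y \<ge> 0" if "T \<in> domino_tilings S" for T x y
    using local_extremum_where_higher[OF A(2,1) that, of "-1" x y] max by force
  have B_min: "height_diff S B T x y \<le> 0" if "T \<in> domino_tilings S" for T x y
    using local_extremum_where_higher[OF B(2,1) that, of "1" x y] min by force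
  have bound: "height_dist S T T' \<le> height_dist S A B"
    if T: "T \<in> domino_tilings S" "T' \<in> domino_tilings S" for T T'
    unfolding height_dist_def
  proof (intro sum_mono, clarify)
    fix x y
    show "\<bar>height_diff S T T' x y\<bar> \<le> \<bar>height_diff S A B x y\<bar>"
      using A_max[OF T(1), of x y] A_max[OF T(2), of x y] B_min[OF T(1), of x y] B_min[OF T(2), of x y]
        height_diff_trans[of S A B x y T] height_diff_trans[of S A B x y T']
        height_diff_trans[of S T T' x y B]
        height_diff_commute[of S T B x y] height_diff_commute[of S T' B x y] by linarith
  qed
  note dist = graph_distance_flip_graph[OF A(2,1)]
  have "graph_diameter (flip_graph S) = ereal (real_of_int (height_dist S A B))"
    unfolding graph_diameter_def
  proof (rule antisym)
    show "(SUP u\<in>pverts (flip_graph S). SUP v\<in>pverts (flip_graph S). graph_distance (flip_graph S) u v)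
      \<le> ereal (real_of_int (height_dist S A B))"
      by (intro SUP_least) (auto simp: flip_graph_def dist[unfolded flip_graph_def] bound)
    show "ereal (real_of_int (height_dist S A B)) \<le>
      (SUP u\<in>pverts (flip_graph S). SUP v\<in>pverts (flip_graph S). graph_distance (flip_graph S) u v)"
      using A(1) B(1) dist[OF A(1) B(1)]
      by (intro SUP_upper2[of A] SUP_upper2[of B]) (auto simp: flip_graph_def)
  qed
  also have "height_dist S A B = (\<Sum>(x, y)\<in>inner_vertices S. d x y)"
    unfolding height_dist_def
  proof (intro sum.cong refl, clarify)
    fix x y assume "(x, y) \<in> inner_vertices S"
    then show "\<bar>height_diff S A B x y\<bar> = d x y" using D A_max[OF B(1), of x y] by simp
  qed
  finally show ?thesis .
qed

end

section \<open>Rectangles\<close>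

definition parity :: "int \<Rightarrow> int \<Rightarrow> int" where
  "parity x y = (x + y) mod 2"

lemma parity_step [simp]:
  "parity (x + 1) y = 1 - parity x y" "parity x (y + 1) = 1 - parity x y"
  "parity (x - 1) y = 1 - parity x y" "parity x (y - 1) = 1 - parity x y"
  unfolding parity_def mod2_eq_if by auto

lemma parity_cases: "parity x y = 0 \<or> parity x y = 1"
  by (auto simp: parity_def)

lemma checker_parity: "checker x y = 1 - 2 * parity x y"
  by (simp add: checker_def parity_def)

text \<open>Height functions of the whole plane with the residue modulo 4 of a fixed one. Any two of them
  differ by multiples of four, so that minima and maxima of them are again of this kind.\<close>

definition free_height :: "(int \<Rightarrow> int \<Rightarrow> int) \<Rightarrow> bool" where
  "free_height F \<longleftrightarrow>
     (\<forall>x y. 4 dvd (F x y - (2 * x - parity x y)) \<and>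
        F (x + 1) y - F x y \<in> {checker x y, - 3 * checker x y} \<and>
        F x (y + 1) - F x y \<in> {- checker x y, 3 * checker x y})"

text \<open>If \<open>f \<noteq> g\<close>, they differ by at least four, while their increments differ by at most four; hence
  the smaller one remains the smaller one.\<close>

lemma min_step:
  fixes a b f g f' g' :: int
  assumes "f' - f \<in> {a, b}" "g' - g \<in> {a, b}" "a - b = 4 \<or> b - a = 4" "4 dvd (f - g)"
  shows "min f' g' - min f g \<in> {a, b}" "max f' g' - max f g \<in> {a, b}"
proof -
  obtain k where k: "f = g + 4 * k" using assms(4) by (metis diff_add_cancel add.commute dvdE)
  consider "k = 0" | "k \<ge> 1" | "k \<le> -1" by linarith
  then have "f = g \<or> g \<le> f \<and> g' \<le> f' \<or> f \<le> g \<and> f' \<le> g'"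
    using assms(1-3) unfolding k by cases auto
  then show "min f' g' - min f g \<in> {a, b}" "max f' g' - max f g \<in> {a, b}"
    using assms(1,2) by (auto simp: min_def max_def)
qed

lemma free_height_min_max:
  assumes "free_height F" "free_height G"
  shows "free_height (\<lambda>x y. min (F x y) (G x y))" "free_height (\<lambda>x y. max (F x y) (G x y))"
proof -
  have F: "4 dvd (F x y - (2 * x - parity x y))"
      "F (x + 1) y - F x y \<in> {checker x y, - 3 * checker x y}"
      "F x (y + 1) - F x y \<in> {- checker x y, 3 * checker x y}" for x y
    using assms(1) unfolding free_height_def by blast+
  have G: "4 dvd (G x y - (2 * x - parity x y))"
      "G (x + 1) y - G x y \<in> {checker x y, - 3 * checker x y}"
      "G x (y + 1) - G x y \<in> {- checker x y, 3 * checker x y}" for x y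
    using assms(2) unfolding free_height_def by blast+
  have dvd: "4 dvd (F x y - G x y)" for x y using dvd_diff[OF F(1)[of x y] G(1)[of x y]] by simp
  have s: "checker x y - - 3 * checker x y = 4 \<or> - 3 * checker x y - checker x y = 4"
    "- checker x y - 3 * checker x y = 4 \<or> 3 * checker x y - - checker x y = 4" for x y
    using checker_cases[of x y] by auto
  note m = min_step[OF F(2) G(2) s(1) dvd] min_step[OF F(3) G(3) s(2) dvd]
  show "free_height (\<lambda>x y. min (F x y) (G x y))" "free_height (\<lambda>x y. max (F x y) (G x y))"
    unfolding free_height_def using m F(1) G(1) by (simp_all add: min_def max_def)
qed

text \<open>The steepest height functions, rising or falling in the direction of one axis.\<close>

lemma free_height_slopes:
  "free_height (\<lambda>x y. 2 * x - parity x y)"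
  "free_height (\<lambda>x y. - 2 * x - parity x y)"
  "free_height (\<lambda>x y. 2 * y + parity x y)"
  "free_height (\<lambda>x y. - 2 * y + parity x y)"
proof -
  have dvd: "4 dvd (F - (2 * x - parity x y))"
    if "F \<in> {2 * x - parity x y, - 2 * x - parity x y, 2 * y + parity x y, - 2 * y + parity x y}" for F x y
  proof -
    define p c where "p = parity x y" and "c = (x + y) div 2"
    have "x + y = 2 * c + p" by (simp add: parity_def p_def c_def)
    then have x: "x = 2 * c + p - y" by linarith
    have "2 * y + p - (2 * x - p) = 4 * (y - c)" "- 2 * y + p - (2 * x - p) = 4 * (- c)"
      "- 2 * x - p - (2 * x - p) = 4 * (- x)"
      by (simp_all add: x)
    then have "4 dvd 2 * y + p - (2 * x - p)" "4 dvd - 2 * y + p - (2 * x - p)"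
      "4 dvd - 2 * x - p - (2 * x - p)" "4 dvd 2 * x - p - (2 * x - p)"
      by (metis dvd_triv_left)+ simp
    then show ?thesis using that unfolding p_def by - (elim insertE emptyE, simp_all only:)
  qed
  show "free_height (\<lambda>x y. 2 * x - parity x y)"
    "free_height (\<lambda>x y. - 2 * x - parity x y)"
    "free_height (\<lambda>x y. 2 * y + parity x y)"
    "free_height (\<lambda>x y. - 2 * y + parity x y)"
    unfolding free_height_def
    by (intro allI conjI dvd; auto simp: checker_def parity_def mod2_eq_if)+
qed

lemma free_height_shift:
  assumes "free_height F" "4 dvd c"
  shows "free_height (\<lambda>x y. F x y + c)"
  using assms unfolding free_height_def
  by (auto simp: add.commute[of _ c] add_diff_eq[symmetric])

text \<open>On a side of the rectangle the heights of all tilings are the same and nearly constant, so the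
  largest possible heights are the minimum of the four steepest functions rising from the sides.
  The terms \<open>m mod 2\<close> and \<open>n mod 2\<close> account for the different boundary values on the right and on
  the upper side when their distance to the opposite side is odd. The least heights arise
  symmetrically.\<close>

definition rect_max :: "int \<Rightarrow> int \<Rightarrow> int \<Rightarrow> int \<Rightarrow> int" where
  "rect_max m n x y =
     min (min (2 * x - parity x y) (- 2 * x - parity x y + (2 * m + 2 * (m mod 2))))
         (min (2 * y + parity x y) (- 2 * y + parity x y + (2 * n - 2 * (n mod 2))))"

definition rect_min :: "int \<Rightarrow> int \<Rightarrow> int \<Rightarrow> int \<Rightarrow> int" where
  "rect_min m n x y =
     max (max (- 2 * x - parity x y) (2 * x - parity x y + (2 * (m mod 2) - 2 * m)))
         (max (- 2 * y + parity x y) (2 * y + parity x y + (- 2 * n - 2 * (n mod 2))))"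

lemma min4: "min (min a b) (min c d) = a \<or> min (min a b) (min c d) = b \<or>
    min (min a b) (min c d) = c \<or> min (min a b) (min c d) = d" for a b c d :: int
  by (auto simp: min_def)

lemma max4: "max (max a b) (max c d) = a \<or> max (max a b) (max c d) = b \<or>
    max (max a b) (max c d) = c \<or> max (max a b) (max c d) = d" for a b c d :: int
  by (auto simp: max_def)

lemma rect_max_le:
  "rect_max m n x y \<le> 2 * x - parity x y"
  "rect_max m n x y \<le> - 2 * x - parity x y + (2 * m + 2 * (m mod 2))"
  "rect_max m n x y \<le> 2 * y + parity x y"
  "rect_max m n x y \<le> - 2 * y + parity x y + (2 * n - 2 * (n mod 2))"
  unfolding rect_max_def min_le_iff_disj by simp_all

lemma rect_max_cases:
  "rect_max m n x y = 2 * x - parity x y \<or>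
   rect_max m n x y = - 2 * x - parity x y + (2 * m + 2 * (m mod 2)) \<or>
   rect_max m n x y = 2 * y + parity x y \<or>
   rect_max m n x y = - 2 * y + parity x y + (2 * n - 2 * (n mod 2))"
  unfolding rect_max_def by (rule min4)

lemma rect_min_ge:
  "- 2 * x - parity x y \<le> rect_min m n x y"
  "2 * x - parity x y + (2 * (m mod 2) - 2 * m) \<le> rect_min m n x y"
  "- 2 * y + parity x y \<le> rect_min m n x y"
  "2 * y + parity x y + (- 2 * n - 2 * (n mod 2)) \<le> rect_min m n x y"
  unfolding rect_min_def le_max_iff_disj by simp_all

lemma rect_min_cases:
  "rect_min m n x y = - 2 * x - parity x y \<or>
   rect_min m n x y = 2 * x - parity x y + (2 * (m mod 2) - 2 * m) \<or>
   rect_min m n x y = - 2 * y + parity x y \<or>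
   rect_min m n x y = 2 * y + parity x y + (- 2 * n - 2 * (n mod 2))"
  unfolding rect_min_def by (rule max4)

lemma free_height_rect:
  "free_height (rect_max m n)" "free_height (rect_min m n)"
proof -
  have "4 dvd 2 * m + 2 * (m mod 2)" "4 dvd 2 * n - 2 * (n mod 2)"
    "4 dvd 2 * (m mod 2) - 2 * m" "4 dvd - 2 * n - 2 * (n mod 2)" by presburger+
  note free_height_slopes(1) free_height_shift[OF free_height_slopes(2) this(1)]
    free_height_slopes(3) free_height_shift[OF free_height_slopes(4) this(2)]
    free_height_slopes(2) free_height_shift[OF free_height_slopes(1) this(3)]
    free_height_slopes(4) free_height_shift[OF free_height_slopes(3) this(4)]
  note free_height_min_max(1)[OF free_height_min_max(1)[OF this(1,2)] free_height_min_max(1)[OF this(3,4)]]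
    free_height_min_max(2)[OF free_height_min_max(2)[OF this(5,6)] free_height_min_max(2)[OF this(7,8)]]
  then show "free_height (rect_max m n)" "free_height (rect_min m n)"
    unfolding rect_max_def[abs_def] rect_min_def[abs_def] by blast+
qed

lemma rectangle_iff: "(x, y) \<in> rectangle m n \<longleftrightarrow> 0 \<le> x \<and> x < int m \<and> 0 \<le> y \<and> y < int n"
  by (auto simp: rectangle_def)

text \<open>The boundary values common to all tilings of the rectangle.\<close>

definition rect_boundary :: "int \<Rightarrow> int \<Rightarrow> (int \<Rightarrow> int \<Rightarrow> int) \<Rightarrow> bool" where
  "rect_boundary m n F \<longleftrightarrow>
     (\<forall>x. 0 \<le> x \<longrightarrow> x \<le> m \<longrightarrow> F x 0 = parity x 0 \<and> F x n = parity x n - 2 * (n mod 2)) \<and>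
     (\<forall>y. 0 \<le> y \<longrightarrow> y \<le> n \<longrightarrow> F 0 y = - parity 0 y \<and> F m y = 2 * (m mod 2) - parity m y)"

lemma height_function_rectangle:
  assumes F: "free_height F" and b: "rect_boundary (int m) (int n) F"
  shows "height_function (rectangle m n) F"
  unfolding height_function_def
proof (intro allI conjI impI)
  fix x y :: int
  show "F (x + 1) y - F x y \<in> {checker x y, - 3 * checker x y}"
    "F x (y + 1) - F x y \<in> {- checker x y, 3 * checker x y}"
    using F unfolding free_height_def by blast+
  show "F (x + 1) y - F x y = checker x y"
    if "((x, y) \<in> rectangle m n) \<noteq> ((x, y - 1) \<in> rectangle m n)"
  proof -
    have "0 \<le> x \<and> x + 1 \<le> int m \<and> (y = 0 \<or> y = int n)" using that by (auto simp: rectangle_iff)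
    then show ?thesis using b unfolding rect_boundary_def by (auto simp: checker_parity)
  qed
  show "F x (y + 1) - F x y = - checker x y"
    if "((x, y) \<in> rectangle m n) \<noteq> ((x - 1, y) \<in> rectangle m n)"
  proof -
    have "0 \<le> y \<and> y + 1 \<le> int n \<and> (x = 0 \<or> x = int m)" using that by (auto simp: rectangle_iff)
    then show ?thesis using b unfolding rect_boundary_def by (auto simp: checker_parity)
  qed
qed

lemma parity_split:
  obtains c where "x + y = 2 * c + parity x y" "parity x y = 0 \<or> parity x y = 1"
  using parity_cases[of x y] by (metis parity_def mult_div_mod_eq)

lemma rect_boundary_max_min:
  assumes mn: "0 < m" "0 < n" "even m \<or> even n"
  shows "rect_boundary m n (rect_max m n)" "rect_boundary m n (rect_min m n)"
proof -
  obtain a b \<mu> \<nu> where ab: "m = 2 * a + \<mu>" "n = 2 * b + \<nu>" "m mod 2 = \<mu>" "n mod 2 = \<nu>"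
      "\<mu> = 0 \<and> \<nu> = 0 \<or> \<mu> = 1 \<and> \<nu> = 0 \<or> \<mu> = 0 \<and> \<nu> = 1"
    using mn(3) by (metis mult_div_mod_eq parity_cases[of m 0] parity_cases[of n 0] parity_def
        add.right_neutral even_iff_mod_2_eq_zero)
  have *: "rect_max m n x y = v \<and> rect_min m n x y = v"
    if "0 \<le> x" "x \<le> m" "0 \<le> y" "y \<le> n"
      "y = 0 \<and> v = parity x y \<or> y = n \<and> v = parity x y - 2 * (n mod 2) \<or>
       x = 0 \<and> v = - parity x y \<or> x = m \<and> v = 2 * (m mod 2) - parity x y" for x y v
  proof -
    obtain c p where "x + y = 2 * c + p" "parity x y = p" "p = 0 \<or> p = 1"
      using parity_split[of x y] by blast
    then show ?thesis using that ab mn unfolding rect_max_def rect_min_def ab(3,4)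
      by (simp only:) (smt (z3))
  qed
  show "rect_boundary m n (rect_max m n)" "rect_boundary m n (rect_min m n)"
    unfolding rect_boundary_def using * mn(1,2) by auto
qed

text \<open>For each side the rising and the falling function differ by four times the distance to that
  side, which gives \<open>\<le>\<close>. For \<open>\<ge>\<close> a rising and a falling function of different sides have to be
  compared, where the rounding is controlled by the parities.\<close>

lemma rect_max_minus_min:
  assumes mn: "0 < m" "0 < n" "even m \<or> even n" and xy: "0 \<le> x" "x \<le> m" "0 \<le> y" "y \<le> n"
  shows "rect_max m n x y - rect_min m n x y = 4 * min (min x (m - x)) (min y (n - y))"
proof -
  obtain a b \<mu> \<nu> where ab: "m = 2 * a + \<mu>" "n = 2 * b + \<nu>" "m mod 2 = \<mu>" "n mod 2 = \<nu>"
      "\<mu> = 0 \<and> \<nu> = 0 \<or> \<mu> = 1 \<and> \<nu> = 0 \<or> \<mu> = 0 \<and> \<nu> = 1"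
    using mn(3) by (metis mult_div_mod_eq parity_cases[of m 0] parity_cases[of n 0] parity_def
        add.right_neutral even_iff_mod_2_eq_zero)
  obtain c p where c: "x + y = 2 * c + p" and p: "parity x y = p" "p = 0 \<or> p = 1"
      using parity_split[of x y] by blast
  define d where "d = min (min x (m - x)) (min y (n - y))"
  have d: "d \<le> x" "d \<le> m - x" "d \<le> y" "d \<le> n - y" "d = x \<or> d = m - x \<or> d = y \<or> d = n - y"
    unfolding d_def by linarith+
  have "rect_max m n x y - rect_min m n x y \<le> 4 * d"
    using d(5) rect_max_le[where x = x and y = y and m = m and n = n]
      rect_min_ge[where x = x and y = y and m = m and n = n] by - (elim disjE; linarith)
  moreover have "4 * d \<le> rect_max m n x y - rect_min m n x y"
    using rect_max_cases[where x = x and y = y and m = m and n = n] rect_min_cases[where x = x and y = y and m = m and n = n]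
    unfolding ab(3,4) p(1) using c p(2) d(1-4) ab(1,2,5)
    by - (elim disjE; smt (z3))
  ultimately show ?thesis unfolding d_def by linarith
qed

lemma rect_no_extremum:
  "\<not> strict_local_max (\<lambda>x y. - rect_max m n x y) x y"
  "\<not> strict_local_max (rect_min m n) x y"
proof -
  obtain p where p: "parity x y = p" "0 \<le> p" "p \<le> 1" using parity_cases[of x y] by auto
  \<comment> \<open>A step towards the nearest side lowers the bound that is attained there.\<close>
  show "\<not> strict_local_max (\<lambda>x y. - rect_max m n x y) x y"
  proof
    assume "strict_local_max (\<lambda>x y. - rect_max m n x y) x y"
    then have "rect_max m n x y < rect_max m n (x - 1) y" "rect_max m n x y < rect_max m n (x + 1) y"
      "rect_max m n x y < rect_max m n x (y - 1)" "rect_max m n x y < rect_max m n x (y + 1)"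
      by (simp_all add: strict_local_max_def)
    moreover note rect_max_le(1)[where x = "x - 1" and y = y and m = m and n = n]
      rect_max_le(2)[where x = "x + 1" and y = y and m = m and n = n]
      rect_max_le(3)[where x = x and y = "y - 1" and m = m and n = n]
      rect_max_le(4)[where x = x and y = "y + 1" and m = m and n = n]
    ultimately show False
      using p(2,3) rect_max_cases[where x = x and y = y and m = m and n = n]
      unfolding parity_step p(1) by (smt (verit))
  qed
  show "\<not> strict_local_max (rect_min m n) x y"
  proof
    assume "strict_local_max (rect_min m n) x y"
    then have "rect_min m n (x - 1) y < rect_min m n x y" "rect_min m n (x + 1) y < rect_min m n x y"
      "rect_min m n x (y - 1) < rect_min m n x y" "rect_min m n x (y + 1) < rect_min m n x y"
      by (simp_all add: strict_local_max_def)
    moreover note rect_min_ge(1)[where x = "x - 1" and y = y and m = m and n = n]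
      rect_min_ge(2)[where x = "x + 1" and y = y and m = m and n = n]
      rect_min_ge(3)[where x = x and y = "y - 1" and m = m and n = n]
      rect_min_ge(4)[where x = x and y = "y + 1" and m = m and n = n]
    ultimately show False
      using p(2,3) rect_min_cases[where x = x and y = y and m = m and n = n]
      unfolding parity_step p(1) by (smt (verit))
  qed
qed

lemma inner_vertices_rectangle:
  "inner_vertices (rectangle m n) = {1..int m - 1} \<times> {1..int n - 1}"
  by (auto simp: inner_vertices_def rectangle_iff)

text \<open>Counting by layers: the vertices at distance at least \<open>k\<close> from all sides form a grid.\<close>

lemma sum_nearest_side:
  assumes "n \<le> m"
  shows "(\<Sum>(x, y)\<in>{1..int m - 1} \<times> {1..int n - 1}. min (min x (int m - x)) (min y (int n - y))) =
    (\<Sum>k = 1..n div 2. (int m + 1 - 2 * int k) * (int n + 1 - 2 * int k))"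
proof -
  let ?V = "{1..int m - 1} \<times> {1..int n - 1}"
  let ?d = "\<lambda>x y. min (min x (int m - x)) (min y (int n - y))"
  have "?d x y = (\<Sum>k = 1..n div 2. of_bool (int k \<le> ?d x y))" if "(x, y) \<in> ?V" for x y
  proof -
    have le: "0 \<le> ?d x y" "?d x y \<le> int (n div 2)" using that by auto
    then have "{1..n div 2} \<inter> {k. int k \<le> ?d x y} = {1..nat (?d x y)}" by (auto simp: le_nat_iff nat_le_iff)
    then have "(\<Sum>k = 1..n div 2. of_bool (int k \<le> ?d x y)) = int (card {1..nat (?d x y)})"
      by (subst sum_of_bool_eq) auto
    then show ?thesis using le(1) by simp
  qed
  then have "(\<Sum>(x, y)\<in>?V. ?d x y) = (\<Sum>(x, y)\<in>?V. \<Sum>k = 1..n div 2. of_bool (int k \<le> ?d x y))"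
    by (intro sum.cong) auto
  also have "\<dots> = (\<Sum>k = 1..n div 2. \<Sum>(x, y)\<in>?V. of_bool (int k \<le> ?d x y))"
    unfolding case_prod_unfold by (rule sum.swap)
  also have "\<dots> = (\<Sum>k = 1..n div 2. (int m + 1 - 2 * int k) * (int n + 1 - 2 * int k))"
  proof (rule sum.cong[OF refl])
    fix k assume "k \<in> {1..n div 2}"
    then have k: "1 \<le> int k" "2 * int k \<le> int n" by auto
    have "(\<Sum>(x, y)\<in>?V. of_bool (int k \<le> ?d x y)) =
        int (card (?V \<inter> {v. int k \<le> ?d (fst v) (snd v)}))"
      unfolding case_prod_unfold
      by (intro sum_of_bool_eq finite_cartesian_product finite_atLeastAtMost_int)
    also have "?V \<inter> {v. int k \<le> ?d (fst v) (snd v)} = {int k..int m - int k} \<times> {int k..int n - int k}"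
      using k by auto
    also have "int (card \<dots>) = (int m + 1 - 2 * int k) * (int n + 1 - 2 * int k)"
      using k assms by (simp add: card_cartesian_product algebra_simps)
    finally show "(\<Sum>(x, y)\<in>?V. of_bool (int k \<le> ?d x y)) =
      (int m + 1 - 2 * int k) * (int n + 1 - 2 * int k)" .
  qed
  finally show ?thesis .
qed

lemma sum_layers:
  "3 * (\<Sum>k = 1..q. (a - 2 * int k) * (b - 2 * int k)) =
    3 * a * b * int q - 3 * (a + b) * int q * (int q + 1) + 2 * int q * (int q + 1) * (2 * int q + 1)"
  by (induction q) (simp_all add: algebra_simps)

theorem graph_diameter_rectangle:
  assumes mn: "1 \<le> n" "n \<le> m" "even m \<or> even n"
  shows "graph_diameter (flip_graph (rectangle m n)) =
    ereal (if even n
           then real m * real n ^ 2 / 4 - real n ^ 3 / 12 - real n / 6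
           else real m * real n ^ 2 / 4 - real n ^ 3 / 12 + real n / 12 - real m / 4)"
proof -
  interpret column_convex_shape "rectangle m n"
    by unfold_locales (auto simp: rectangle_def column_convex_def)
  have pos: "0 < int m" "0 < int n" "even (int m) \<or> even (int n)" using mn by auto
  note boundary = rect_boundary_max_min[OF pos]
  let ?d = "\<lambda>x y. min (min x (int m - x)) (min y (int n - y))"
  define D where "D = (\<Sum>k = 1..n div 2. (int m + 1 - 2 * int k) * (int n + 1 - 2 * int k))"
  have "graph_diameter (flip_graph (rectangle m n)) =
      ereal (real_of_int (\<Sum>(x, y)\<in>inner_vertices (rectangle m n). ?d x y))"
  proof (rule graph_diameter_flip_graph)
    show "height_function (rectangle m n) (rect_max (int m) (int n))"
      "height_function (rectangle m n) (rect_min (int m) (int n))"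
      by (intro height_function_rectangle free_height_rect boundary)+
    fix x y
    show "rect_max (int m) (int n) x y = rect_min (int m) (int n) x y"
      if "(x, y) \<in> rectangle m n" "(x - 1, y) \<in> rectangle m n"
        "(x, y) \<notin> inner_vertices (rectangle m n)"
    proof -
      have "y = 0" "0 \<le> x" "x \<le> int m" using that by (auto simp: inner_vertices_rectangle rectangle_iff)
      then show ?thesis using boundary by (auto simp: rect_boundary_def)
    qed
    show "rect_max (int m) (int n) x y - rect_min (int m) (int n) x y = 4 * ?d x y"
      if "(x, y) \<in> inner_vertices (rectangle m n)"
      using that by (intro rect_max_minus_min pos) (auto simp: inner_vertices_rectangle)
  qed (rule rect_no_extremum)+
  also have "(\<Sum>(x, y)\<in>inner_vertices (rectangle m n). ?d x y) = D"
    unfolding inner_vertices_rectangle sum_nearest_side[OF mn(2)] D_def ..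
  finally have diam: "graph_diameter (flip_graph (rectangle m n)) = ereal (real_of_int D)" .
  define q where "q = n div 2"
  have "3 * D = 3 * (int m + 1) * (int n + 1) * int q - 3 * (int m + int n + 2) * int q * (int q + 1) +
      2 * int q * (int q + 1) * (2 * int q + 1)"
    unfolding D_def q_def[symmetric] using sum_layers[of "int m + 1" "int n + 1" q] by simp
  then have "real_of_int (3 * D) = real_of_int (3 * (int m + 1) * (int n + 1) * int q -
      3 * (int m + int n + 2) * int q * (int q + 1) + 2 * int q * (int q + 1) * (2 * int q + 1))"
    by simp
  then have D: "real_of_int D = (real m + 1) * (real n + 1) * real q -
      (real m + real n + 2) * real q * (real q + 1) + 2 * real q * (real q + 1) * (2 * real q + 1) / 3"
    by (simp add: field_simps)
  show ?thesis
  proof (cases "even n")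
    case True
    then have "real n = 2 * real q" unfolding q_def by auto
    then show ?thesis unfolding diam D using True
      by (simp add: field_simps power2_eq_square power3_eq_cube)
  next
    case False
    then have "n = 2 * q + 1" unfolding q_def by presburger
    then have "real n = 2 * real q + 1" by simp
    then show ?thesis unfolding diam D using False
      by (simp add: field_simps power2_eq_square power3_eq_cube)
  qed
qed

section \<open>Aztec diamonds\<close>

lemma aztec_diamond_iff:
  "(x, y) \<in> aztec_diamond n \<longleftrightarrow> \<bar>2 * x + 1\<bar> + \<bar>2 * y + 1\<bar> \<le> 2 * int n"
proof
  assume xy: "(x, y) \<in> aztec_diamond n"
  \<comment> \<open>The corner of the square that is farthest from the origin.\<close>
  define a b where "a = (if 0 \<le> x then x + 1 else x)" and "b = (if 0 \<le> y then y + 1 else y)"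
  have "(of_int a, of_int b) \<in> unit_square (x, y)" by (auto simp: a_def b_def)
  then have "\<bar>of_int a\<bar> + \<bar>of_int b\<bar> \<le> real n + 1" using xy unfolding aztec_diamond_def by blast
  then have "\<bar>a\<bar> + \<bar>b\<bar> \<le> int n + 1" by linarith
  moreover have "\<bar>2 * x + 1\<bar> = 2 * \<bar>a\<bar> - 1" "\<bar>2 * y + 1\<bar> = 2 * \<bar>b\<bar> - 1" by (auto simp: a_def b_def)
  ultimately show "\<bar>2 * x + 1\<bar> + \<bar>2 * y + 1\<bar> \<le> 2 * int n" by linarith
next
  assume le: "\<bar>2 * x + 1\<bar> + \<bar>2 * y + 1\<bar> \<le> 2 * int n"
  have bound: "2 * \<bar>u\<bar> \<le> of_int (\<bar>2 * i + 1\<bar> + 1)" if "of_int i \<le> u" "u \<le> of_int i + 1" for u :: real and i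
    using that by (cases "0 \<le> i") auto
  have "\<bar>u\<bar> + \<bar>v\<bar> \<le> real n + 1"
    if "of_int x \<le> u" "u \<le> of_int x + 1" "of_int y \<le> v" "v \<le> of_int y + 1" for u v :: real
  proof -
    have "2 * (\<bar>u\<bar> + \<bar>v\<bar>) \<le> of_int (\<bar>2 * x + 1\<bar> + \<bar>2 * y + 1\<bar> + 2)"
      using bound[OF that(1,2)] bound[OF that(3,4)] by simp
    also have "\<dots> \<le> of_int (2 * int n + 2)" using le by (simp only: of_int_le_iff)
    finally show ?thesis by simp
  qed
  then show "(x, y) \<in> aztec_diamond n" by (auto simp: aztec_diamond_def)
qed

lemma column_convex_aztec: "column_convex_shape (aztec_diamond n)"
proof
  have "aztec_diamond n \<subseteq> {- int n - 1..int n + 1} \<times> {- int n - 1..int n + 1}"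
  proof
    fix c assume "c \<in> aztec_diamond n"
    then show "c \<in> {- int n - 1..int n + 1} \<times> {- int n - 1..int n + 1}"
      by (cases c) (simp add: aztec_diamond_iff, linarith)
  qed
  then show "finite (aztec_diamond n)" by (rule finite_subset) simp
  show "column_convex (aztec_diamond n)"
    unfolding column_convex_def aztec_diamond_iff by (intro allI impI) linarith
qed

lemma inner_vertices_aztec:
  "(x, y) \<in> inner_vertices (aztec_diamond n) \<longleftrightarrow> \<bar>x\<bar> + \<bar>y\<bar> \<le> int n - 1"
  unfolding inner_vertices_def mem_Collect_eq case_prod_conv aztec_diamond_iff
  by (smt (z3))

text \<open>Along each of the four staircase sides of the Aztec diamond the heights are monotone, and their
  steepest continuations into the interior depend on one coordinate only, up to the parity. These
  are the heights of the tilings by horizontal and by vertical dominoes only. The former is the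
  higher one exactly if the order \<open>n\<close> is even.\<close>

definition aztec_hor :: "nat \<Rightarrow> int \<Rightarrow> int \<Rightarrow> int" where
  "aztec_hor n x y = (if even n then 2 * int n - 2 * \<bar>y\<bar> + parity x y
     else 2 * \<bar>y\<bar> + parity x y - (2 * int n + 2))"

definition aztec_ver :: "nat \<Rightarrow> int \<Rightarrow> int \<Rightarrow> int" where
  "aztec_ver n x y = (if even n then 2 * \<bar>x\<bar> - parity x y else - 2 * \<bar>x\<bar> - parity x y)"

lemma free_height_aztec: "free_height (aztec_hor n)" "free_height (aztec_ver n)"
proof -
  note s = free_height_slopes
  have "4 dvd 2 * int n" if "even n" using that by auto
  then have "free_height (\<lambda>x y. min (2 * y + parity x y) (- 2 * y + parity x y) + 2 * int n)" if "even n"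
    using that by (intro free_height_shift free_height_min_max s)
  moreover have "4 dvd - 2 * int n - 2" if "odd n" using that by (auto elim!: oddE)
  then have "free_height (\<lambda>x y. max (2 * y + parity x y) (- 2 * y + parity x y) + (- 2 * int n - 2))" if "odd n"
    using that by (intro free_height_shift free_height_min_max s)
  moreover have "aztec_hor n = (if even n
      then (\<lambda>x y. min (2 * y + parity x y) (- 2 * y + parity x y) + 2 * int n)
      else (\<lambda>x y. max (2 * y + parity x y) (- 2 * y + parity x y) + (- 2 * int n - 2)))"
    by (auto simp: aztec_hor_def fun_eq_iff min_def max_def)
  ultimately show "free_height (aztec_hor n)" by simp
  have "aztec_ver n = (if even n
      then (\<lambda>x y. max (2 * x - parity x y) (- 2 * x - parity x y))
      else (\<lambda>x y. min (2 * x - parity x y) (- 2 * x - parity x y)))"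
    by (auto simp: aztec_ver_def fun_eq_iff min_def max_def)
  then show "free_height (aztec_ver n)" using free_height_min_max[OF s(1,2)] by simp
qed

lemma parity_diamond:
  "\<bar>x\<bar> + \<bar>y\<bar> = int n \<Longrightarrow> parity x y = of_bool (odd n)"
  "\<bar>x\<bar> + \<bar>y\<bar> = int n + 1 \<Longrightarrow> parity x y = of_bool (even n)"
proof -
  have "parity x y = (\<bar>x\<bar> + \<bar>y\<bar>) mod 2" unfolding parity_def by (auto simp: abs_if mod2_eq_if)
  then show "\<bar>x\<bar> + \<bar>y\<bar> = int n \<Longrightarrow> parity x y = of_bool (odd n)"
    "\<bar>x\<bar> + \<bar>y\<bar> = int n + 1 \<Longrightarrow> parity x y = of_bool (even n)" by (auto simp: mod2_eq_if)
qed

lemma aztec_boundary: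
  "((x, y) \<in> aztec_diamond n) \<noteq> ((x, y - 1) \<in> aztec_diamond n) \<Longrightarrow>
     \<bar>x\<bar> + \<bar>y\<bar> = int n \<and> \<bar>x + 1\<bar> + \<bar>y\<bar> = int n + 1 \<or> \<bar>x\<bar> + \<bar>y\<bar> = int n + 1 \<and> \<bar>x + 1\<bar> + \<bar>y\<bar> = int n"
  "((x, y) \<in> aztec_diamond n) \<noteq> ((x - 1, y) \<in> aztec_diamond n) \<Longrightarrow>
     \<bar>x\<bar> + \<bar>y\<bar> = int n \<and> \<bar>x\<bar> + \<bar>y + 1\<bar> = int n + 1 \<or> \<bar>x\<bar> + \<bar>y\<bar> = int n + 1 \<and> \<bar>x\<bar> + \<bar>y + 1\<bar> = int n"
  unfolding aztec_diamond_iff by (smt (z3))+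

lemma height_function_aztec:
  "height_function (aztec_diamond n) (aztec_hor n)" "height_function (aztec_diamond n) (aztec_ver n)"
proof -
  have "height_function (aztec_diamond n) F" if F: "free_height F" "F = aztec_hor n \<or> F = aztec_ver n" for F
    unfolding height_function_def
  proof (intro allI conjI impI)
    fix x y
    show "F (x + 1) y - F x y \<in> {checker x y, - 3 * checker x y}"
      "F x (y + 1) - F x y \<in> {- checker x y, 3 * checker x y}"
      using F(1) unfolding free_height_def by blast+
    show "F (x + 1) y - F x y = checker x y"
      if "((x, y) \<in> aztec_diamond n) \<noteq> ((x, y - 1) \<in> aztec_diamond n)"
      using aztec_boundary(1)[OF that] F(2) parity_diamond[of x y n]
      by (auto simp: aztec_hor_def aztec_ver_def checker_parity)
    show "F x (y + 1) - F x y = - checker x y"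
      if "((x, y) \<in> aztec_diamond n) \<noteq> ((x - 1, y) \<in> aztec_diamond n)"
      using aztec_boundary(2)[OF that] F(2) parity_diamond[of x y n]
      by (auto simp: aztec_hor_def aztec_ver_def checker_parity)
  qed
  then show "height_function (aztec_diamond n) (aztec_hor n)" "height_function (aztec_diamond n) (aztec_ver n)"
    using free_height_aztec by blast+
qed

text \<open>Each of the functions is monotone in the distance from the origin along one axis, so a step away
  from the origin along this axis leads to a lower or higher value, as needed.\<close>

lemma aztec_no_extremum:
  "even n \<Longrightarrow> \<not> strict_local_max (\<lambda>x y. - aztec_hor n x y) x y"
  "even n \<Longrightarrow> \<not> strict_local_max (aztec_ver n) x y"
  "odd n \<Longrightarrow> \<not> strict_local_max (aztec_hor n) x y"
  "odd n \<Longrightarrow> \<not> strict_local_max (\<lambda>x y. - aztec_ver n x y) x y"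
proof -
  obtain p where p: "parity x y = p" "0 \<le> p" "p \<le> 1" using parity_cases[of x y] by auto
  show "even n \<Longrightarrow> \<not> strict_local_max (\<lambda>x y. - aztec_hor n x y) x y"
    "even n \<Longrightarrow> \<not> strict_local_max (aztec_ver n) x y"
    "odd n \<Longrightarrow> \<not> strict_local_max (aztec_hor n) x y"
    "odd n \<Longrightarrow> \<not> strict_local_max (\<lambda>x y. - aztec_ver n x y) x y"
    using p(2,3) by (auto simp: strict_local_max_def aztec_hor_def aztec_ver_def p(1) abs_if split: if_splits)
qed

lemma aztec_hor_minus_ver:
  "aztec_hor n x y - aztec_ver n x y =
    (if even n then 4 else - 4) * ((int n + 1 - \<bar>x\<bar> - \<bar>y\<bar>) div 2)"
proof -
  have p: "parity x y = (\<bar>x\<bar> + \<bar>y\<bar>) mod 2" unfolding parity_def by (auto simp: abs_if mod2_eq_if)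
  obtain t where t: "t = \<bar>x\<bar> + \<bar>y\<bar>" by blast
  have "2 * int n - 2 * t + 2 * (t mod 2) = 4 * ((int n + 1 - t) div 2)" if "even n"
    using that by presburger
  moreover have "2 * t + 2 * (t mod 2) - (2 * int n + 2) = - 4 * ((int n + 1 - t) div 2)" if "odd n"
    using that by presburger
  ultimately show ?thesis unfolding aztec_hor_def aztec_ver_def p t by (auto simp: algebra_simps)
qed

text \<open>Rotated by an eighth of a turn, these points form a square grid.\<close>

lemma card_parity_diamond:
  "card {(x, y). \<bar>x\<bar> + \<bar>y\<bar> \<le> int r \<and> even (int r + x + y)} = (r + 1)\<^sup>2"
proof -
  let ?f = "\<lambda>(a, b). (a + b - int r, a - b)"
  have "bij_betw ?f ({0..int r} \<times> {0..int r}) {(x, y). \<bar>x\<bar> + \<bar>y\<bar> \<le> int r \<and> even (int r + x + y)}"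
  proof (rule bij_betw_imageI)
    show "inj_on ?f ({0..int r} \<times> {0..int r})" by (auto simp: inj_on_def)
    have "(x, y) \<in> ?f ` ({0..int r} \<times> {0..int r})"
      if xy: "\<bar>x\<bar> + \<bar>y\<bar> \<le> int r" "even (int r + x + y)" for x y
    proof -
      obtain a where a: "int r + x + y = 2 * a" using xy(2) by (rule evenE)
      have "(x, y) = ?f (a, a - y)" using a by simp
      moreover have "(a, a - y) \<in> {0..int r} \<times> {0..int r}" using a xy(1) by auto
      ultimately show ?thesis by (rule image_eqI)
    qed
    moreover have "even (int r + (a + b - int r) + (a - b))" for a b
      by (simp add: algebra_simps)
    ultimately show "?f ` ({0..int r} \<times> {0..int r}) =
        {(x, y). \<bar>x\<bar> + \<bar>y\<bar> \<le> int r \<and> even (int r + x + y)}"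
      by auto
  qed
  then have "card {(x, y). \<bar>x\<bar> + \<bar>y\<bar> \<le> int r \<and> even (int r + x + y)} = card ({0..int r} \<times> {0..int r})"
    by (simp add: bij_betw_same_card)
  then show ?thesis by (simp add: card_cartesian_product power2_eq_square nat_add_distrib)
qed

text \<open>Increasing the order by one increases the summand by one at the vertices with \<open>\<bar>x\<bar> + \<bar>y\<bar>\<close> at
  most \<open>n\<close> and of the parity of \<open>n\<close>.\<close>

lemma sum_diamond:
  "6 * (\<Sum>(x, y) | \<bar>x\<bar> + \<bar>y\<bar> \<le> int n - 1. (int n + 1 - \<bar>x\<bar> - \<bar>y\<bar>) div 2) =
    int n * (int n + 1) * (2 * int n + 1)"
proof (induction n)
  case 0
  have "{(x, y). \<bar>x\<bar> + \<bar>y\<bar> \<le> int 0 - 1} = {}" by auto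
  then show ?case by simp
next
  case (Suc n)
  let ?V = "\<lambda>n. {(x, y). \<bar>x\<bar> + \<bar>y\<bar> \<le> int n - 1}"
  let ?d = "\<lambda>n x y. (int n + 1 - \<bar>x\<bar> - \<bar>y\<bar>) div 2"
  have fin: "finite (?V (Suc n))"
    by (rule finite_subset[of _ "{- int n..int n} \<times> {- int n..int n}"]) auto
  have "(\<Sum>(x, y)\<in>?V (Suc n). ?d (Suc n) x y) =
      (\<Sum>(x, y)\<in>?V (Suc n). ?d n x y + of_bool (even (int n + x + y)))"
  proof (intro sum.cong refl, clarify)
    fix x y
    have "even (int n + x + y) \<longleftrightarrow> even (int n - (\<bar>x\<bar> + \<bar>y\<bar>))" by (auto simp: abs_if)
    moreover have half: "(k + 2 - t) div 2 = (k + 1 - t) div 2 + of_bool (even (k - t))" for k t :: int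
      unfolding of_bool_def by presburger
    ultimately show "?d (Suc n) x y = ?d n x y + of_bool (even (int n + x + y))"
      using half[of "int n" "\<bar>x\<bar> + \<bar>y\<bar>"] by (simp add: algebra_simps)
  qed
  also have "\<dots> = (\<Sum>(x, y)\<in>?V (Suc n). ?d n x y) + (\<Sum>(x, y)\<in>?V (Suc n). of_bool (even (int n + x + y)))"
    unfolding case_prod_unfold by (rule sum.distrib)
  also have "(\<Sum>(x, y)\<in>?V (Suc n). ?d n x y) = (\<Sum>(x, y)\<in>?V n. ?d n x y)"
    by (rule sum.mono_neutral_right[OF fin]) auto
  also have "(\<Sum>(x, y)\<in>?V (Suc n). of_bool (even (int n + x + y))) =
      int (card (?V (Suc n) \<inter> {v. even (int n + fst v + snd v)}))"
    using fin unfolding case_prod_unfold by (intro sum_of_bool_eq) auto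
  also have "?V (Suc n) \<inter> {v. even (int n + fst v + snd v)} =
      {(x, y). \<bar>x\<bar> + \<bar>y\<bar> \<le> int n \<and> even (int n + x + y)}" by auto
  also have "int (card {(x, y). \<bar>x\<bar> + \<bar>y\<bar> \<le> int n \<and> even (int n + x + y)}) = (int n + 1)\<^sup>2"
    unfolding card_parity_diamond by simp
  finally show ?case
    by (simp only: distrib_left Suc.IH) (simp add: power2_eq_square algebra_simps)
qed

theorem graph_diameter_aztec_diamond:
  "graph_diameter (flip_graph (aztec_diamond n)) =
    ereal (real n ^ 3 / 3 + real n ^ 2 / 2 + real n / 6)"
proof -
  interpret column_convex_shape "aztec_diamond n" by (rule column_convex_aztec)
  let ?d = "\<lambda>x y. (int n + 1 - \<bar>x\<bar> - \<bar>y\<bar>) div 2"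
  have base: "aztec_hor n x y = aztec_ver n x y"
    if "(x, y) \<in> aztec_diamond n" "(x - 1, y) \<in> aztec_diamond n"
      "(x, y) \<notin> inner_vertices (aztec_diamond n)" for x y
  proof -
    have "\<bar>x\<bar> + \<bar>y\<bar> = int n" using that unfolding aztec_diamond_iff inner_vertices_aztec by (smt (z3))
    then have "?d x y = 0" by simp
    then show ?thesis using aztec_hor_minus_ver[of n x y] by simp
  qed
  have "graph_diameter (flip_graph (aztec_diamond n)) =
      ereal (real_of_int (\<Sum>(x, y)\<in>inner_vertices (aztec_diamond n). ?d x y))"
  proof (cases "even n")
    case True
    show ?thesis
      by (rule graph_diameter_flip_graph[OF height_function_aztec])
        (use base True aztec_no_extremum aztec_hor_minus_ver in auto)
  next
    case False
    show ?thesis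
      by (rule graph_diameter_flip_graph[OF height_function_aztec(2,1)])
        (use base False aztec_no_extremum aztec_hor_minus_ver in \<open>auto simp: algebra_simps\<close>)
  qed
  also have "inner_vertices (aztec_diamond n) = {(x, y). \<bar>x\<bar> + \<bar>y\<bar> \<le> int n - 1}"
    using inner_vertices_aztec by auto
  finally have diam: "graph_diameter (flip_graph (aztec_diamond n)) =
      ereal (real_of_int (\<Sum>(x, y) | \<bar>x\<bar> + \<bar>y\<bar> \<le> int n - 1. ?d x y))" .
  define D where "D = (\<Sum>(x, y) | \<bar>x\<bar> + \<bar>y\<bar> \<le> int n - 1. ?d x y)"
  have "real_of_int (6 * D) = real_of_int (int n * (int n + 1) * (2 * int n + 1))"
    unfolding D_def sum_diamond ..
  then have "real_of_int D = real n * (real n + 1) * (2 * real n + 1) / 6" by simp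
  then show ?thesis unfolding diam D_def[symmetric]
    by (simp add: field_simps power2_eq_square power3_eq_cube)
qed

section \<open>Diameters of the flip graphs\<close>

theorem theoremC:
  fixes m n :: nat
  assumes "m \<ge> 1" and "n \<ge> 1"
  shows "(even n \<longrightarrow>
           graph_diameter (flip_graph (rectangle n n)) = ereal ((real n ^ 3 - real n) / 6)) \<and>
         (m \<ge> n \<and> (even m \<or> even n) \<longrightarrow>
           graph_diameter (flip_graph (rectangle m n)) =
             ereal (if even n
                    then real m * real n ^ 2 / 4 - real n ^ 3 / 12 - real n / 6
                    else real m * real n ^ 2 / 4 - real n ^ 3 / 12 + real n / 12 - real m / 4)) \<and>
         graph_diameter (flip_graph (aztec_diamond n)) =
           ereal (real n ^ 3 / 3 + real n ^ 2 / 2 + real n / 6)"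
proof (intro conjI impI)
  have "graph_diameter (flip_graph (rectangle n n)) =
      ereal (real n * real n ^ 2 / 4 - real n ^ 3 / 12 - real n / 6)" if "even n"
    using graph_diameter_rectangle[of n n] assms(2) that by simp
  moreover have "real n * real n ^ 2 / 4 - real n ^ 3 / 12 - real n / 6 = (real n ^ 3 - real n) / 6"
    by (simp add: field_simps power2_eq_square power3_eq_cube)
  ultimately show "graph_diameter (flip_graph (rectangle n n)) = ereal ((real n ^ 3 - real n) / 6)"
    if "even n" using that by simp
qed (use graph_diameter_rectangle[of n m] graph_diameter_aztec_diamond[of n] assms(2) in auto)

end
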